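(* Let $H=\sum_{j\in\mathcal{J}}\kappa_j(\rho(h_j)-\mathbb{O}(h_j))$ be the Hamiltonian of a stochastic rewriting system and $\mathsf{O}=\{O_i\}_{i\in\mathcal{I}}$ a polynomially jump-closed set of connected observables for $H$. Suppose (i) for all $i\in\mathcal{I},j\in\mathcal{J}$ there is $\eta_{ij}\in\mathbb{Z}$ with $ad_{O_i}(\rho(h_j))=\eta_{ij}\rho(h_j)$, and (ii) for all $j$ there exist $\alpha_j\in\mathbb{R}$ and $\vec k_j\in\mathbb{Z}_{\ge0}^{\mathcal{I}}$ with $\langle|\rho(h_j)=\alpha_j\sum_{\vec n=\vec 0}^{\vec k_j}s_1(\vec k_j,\vec n)\langle|\vec O^{\vec n}$, where $s_1(\vec k_j,\vec n):=\prod_{i}s_1((\vec k_j)_i;n_i)$ with $s_1$ the signed Stirling numbers of the first kind and $\vec O^{\vec n}=\prod_iO_i^{n_i}$. Then for every bijection $F:\mathcal{I}\to\mathcal{C}$ onto a set of vertex colors, with $\mathsf{O}_{discr}:=\{\hat n_c\}_{c\in\mathcal{C}}$ (vertex-counting observables of color $c$) and $H_{discr}:=\sum_j\alpha_j\kappa_j(\rho(\tilde h_j)-\mathbb{O}(\tilde h_j))$, $\tilde h_j:=\delta(\vec\bullet^{(\vec\eta_j+\vec k_j)}\hookleftarrow\emptyset\hookrightarrow\vec\bullet^{\vec k_j})$, $(\vec\eta_j)_i:=\eta_{ij}$, the pair $(H,\mathsf{O})$ is moment bisimilar to $(H_{discr},\mathsf{O}_{discr})$ via $f(O_i):=\hat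 n_{F(i)}$.
   Context: Setting: stochastic rewriting systems over a finitary adhesive, extensive category, with $\rho$ the canonical representation of the DPO rule algebra and $\mathbb{O}(\delta(O\overset{o}{\hookleftarrow}K\overset{i}{\hookrightarrow}I)):=\rho(\delta(I\overset{i}{\hookleftarrow}K\overset{i}{\hookrightarrow}I))$. $\langle|$ sums the coefficients of a state; $ad_AB=AB-BA$. $\vec\bullet^{\vec n}$ denotes the discrete (edgeless) graph with $n_c$ vertices of color $c$. Polynomial jump-closure: for all $n$, $\langle|ad^{\circ n}_{\vec\lambda\cdot\vec O}H$ equals $\langle|$ applied to a polynomial in the $O_i$. Two pairs $(H_1,\mathsf{O}_1)$, $(H_2,\mathsf{O}_2)$ of Hamiltonians with equinumerous polynomially jump-closed sets of connected observables are moment bisimilar via a bijection $f:\mathsf{O}_1\to\mathsf{O}_2$ if $\big(\big[\langle|(e^{ad_{\vec\lambda\cdot\vec O}}H_1)\big]\big|_{O_i\to\partial/\partial\lambda_i}\big)|\emptyset\rangle=\big(\big[\langle|(e^{ad_{\vec\lambda\cdot\vec{f(O)}}}H_2)\big]\big|_{f(O_i)\to\partial/\partial\lambda_i}\big)|\emptyset\rangle$, i.e. their exponential moment generating functions obey the same evolution PDE.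
   Formalization: It is additionally assumed that η_ij + (k_j)_i ≥ 0 for all i, j, since (i) and (ii) do not imply it and otherwise the discrete graph with η_j + k_j vertices in the rule h̃_j is undefined. *)

theory Defs
  imports "HOL-Analysis.Finite_Function_Topology" "HOL-Combinatorics.Stirling"
begin

section \<open>Finitary adhesive extensive categories\<close>

record ('o, 'a) cat =
  Obj :: "'o set"
  Arr :: "'a set"
  Dom :: "'a \<Rightarrow> 'o"
  Cod :: "'a \<Rightarrow> 'o"
  Ide :: "'o \<Rightarrow> 'a"
  Comp :: "'a \<Rightarrow> 'a \<Rightarrow> 'a"  (infixl "\<cdot>\<index>" 70)

definition hom :: "('o, 'a) cat \<Rightarrow> 'o \<Rightarrow> 'o \<Rightarrow> 'a set"
  where "hom C X Y = {f \<in> Arr C. Dom C f = X \<and> Cod C f = Y}"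

locale category =
  fixes C :: "('o, 'a) cat" (structure)
  assumes Dom_Obj: "f \<in> Arr C \<Longrightarrow> Dom C f \<in> Obj C"
    and Cod_Obj: "f \<in> Arr C \<Longrightarrow> Cod C f \<in> Obj C"
    and Ide_hom: "X \<in> Obj C \<Longrightarrow> Ide C X \<in> hom C X X"
    and Comp_hom: "\<lbrakk>f \<in> hom C X Y; g \<in> hom C Y Z\<rbrakk> \<Longrightarrow> g \<cdot> f \<in> hom C X Z"
    and Comp_Ide_left: "f \<in> hom C X Y \<Longrightarrow> Ide C Y \<cdot> f = f"
    and Comp_Ide_right: "f \<in> hom C X Y \<Longrightarrow> f \<cdot> Ide C X = f"
    and Comp_assoc: "\<lbrakk>f \<in> hom C W X; g \<in> hom C X Y; k \<in> hom C Y Z\<rbrakk>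
      \<Longrightarrow> (k \<cdot> g) \<cdot> f = k \<cdot> (g \<cdot> f)"

definition monic :: "('o, 'a) cat \<Rightarrow> 'a \<Rightarrow> bool"
  where "monic C m \<longleftrightarrow> m \<in> Arr C \<and>
    (\<forall>Z. \<forall>f \<in> hom C Z (Dom C m). \<forall>g \<in> hom C Z (Dom C m). m \<cdot>\<^bsub>C\<^esub> f = m \<cdot>\<^bsub>C\<^esub> g \<longrightarrow> f = g)"

definition iso_arr :: "('o, 'a) cat \<Rightarrow> 'a \<Rightarrow> bool"
  where "iso_arr C f \<longleftrightarrow> f \<in> Arr C \<and>
    (\<exists>g \<in> hom C (Cod C f) (Dom C f). g \<cdot>\<^bsub>C\<^esub> f = Ide C (Dom C f) \<and> f \<cdot>\<^bsub>C\<^esub> g = Ide C (Cod C f))"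

definition iso_obj :: "('o, 'a) cat \<Rightarrow> 'o \<Rightarrow> 'o \<Rightarrow> bool"
  where "iso_obj C X Y \<longleftrightarrow> (\<exists>f \<in> hom C X Y. iso_arr C f)"

definition is_initial :: "('o, 'a) cat \<Rightarrow> 'o \<Rightarrow> bool"
  where "is_initial C Z \<longleftrightarrow> Z \<in> Obj C \<and> (\<forall>X \<in> Obj C. \<exists>!f. f \<in> hom C Z X)"

text \<open>The two arguments are the coprojections.\<close>

definition is_coproduct :: "('o, 'a) cat \<Rightarrow> 'a \<Rightarrow> 'a \<Rightarrow> bool"
  where "is_coproduct C a b \<longleftrightarrow> a \<in> Arr C \<and> b \<in> Arr C \<and> Cod C a = Cod C b \<and>
    (\<forall>T. \<forall>f \<in> hom C (Dom C a) T. \<forall>g \<in> hom C (Dom C b) T.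
      \<exists>!u. u \<in> hom C (Cod C a) T \<and> u \<cdot>\<^bsub>C\<^esub> a = f \<and> u \<cdot>\<^bsub>C\<^esub> b = g)"

text \<open>\<open>is_pushout C f g p q\<close>: the span is \<open>(f, g)\<close>, the cocone is \<open>(p, q)\<close>, and \<open>p \<cdot> f = q \<cdot> g\<close>.\<close>

definition is_pushout :: "('o, 'a) cat \<Rightarrow> 'a \<Rightarrow> 'a \<Rightarrow> 'a \<Rightarrow> 'a \<Rightarrow> bool"
  where "is_pushout C f g p q \<longleftrightarrow>
    f \<in> Arr C \<and> g \<in> Arr C \<and> p \<in> Arr C \<and> q \<in> Arr C \<and>
    Dom C f = Dom C g \<and> Dom C p = Cod C f \<and> Dom C q = Cod C g \<and> Cod C p = Cod C q \<and>
    p \<cdot>\<^bsub>C\<^esub> f = q \<cdot>\<^bsub>C\<^esub> g \<and>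
    (\<forall>T. \<forall>p' \<in> hom C (Cod C f) T. \<forall>q' \<in> hom C (Cod C g) T. p' \<cdot>\<^bsub>C\<^esub> f = q' \<cdot>\<^bsub>C\<^esub> g \<longrightarrow>
      (\<exists>!u. u \<in> hom C (Cod C p) T \<and> u \<cdot>\<^bsub>C\<^esub> p = p' \<and> u \<cdot>\<^bsub>C\<^esub> q = q'))"

text \<open>\<open>is_pullback C p q f g\<close>: the cone is \<open>(p, q)\<close>, the cospan is \<open>(f, g)\<close>, and \<open>f \<cdot> p = g \<cdot> q\<close>.\<close>

definition is_pullback :: "('o, 'a) cat \<Rightarrow> 'a \<Rightarrow> 'a \<Rightarrow> 'a \<Rightarrow> 'a \<Rightarrow> bool"
  where "is_pullback C p q f g \<longleftrightarrow>
    f \<in> Arr C \<and> g \<in> Arr C \<and> p \<in> Arr C \<and> q \<in> Arr C \<and>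
    Cod C f = Cod C g \<and> Cod C p = Dom C f \<and> Cod C q = Dom C g \<and> Dom C p = Dom C q \<and>
    f \<cdot>\<^bsub>C\<^esub> p = g \<cdot>\<^bsub>C\<^esub> q \<and>
    (\<forall>T. \<forall>p' \<in> hom C T (Dom C f). \<forall>q' \<in> hom C T (Dom C g). f \<cdot>\<^bsub>C\<^esub> p' = g \<cdot>\<^bsub>C\<^esub> q' \<longrightarrow>
      (\<exists>!u. u \<in> hom C T (Dom C p) \<and> p \<cdot>\<^bsub>C\<^esub> u = p' \<and> q \<cdot>\<^bsub>C\<^esub> u = q'))"

text \<open>The van Kampen condition on a pushout \<open>p \<cdot> f = q \<cdot> g\<close>. In the cubes considered the given
  square is the bottom face, \<open>p' \<cdot> f' = q' \<cdot> g'\<close> is the top face, and \<open>a\<close>, \<open>b\<close>, \<open>d\<close>, \<open>e\<close> are the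
  vertical arrows.\<close>

definition is_van_kampen :: "('o, 'a) cat \<Rightarrow> 'a \<Rightarrow> 'a \<Rightarrow> 'a \<Rightarrow> 'a \<Rightarrow> bool"
  where "is_van_kampen C f g p q \<longleftrightarrow> is_pushout C f g p q \<and>
    (\<forall>f' g' p' q' a b d e.
      a \<in> hom C (Dom C f') (Dom C f) \<and> b \<in> hom C (Cod C f') (Cod C f) \<and>
      d \<in> hom C (Cod C g') (Cod C g) \<and> e \<in> hom C (Cod C p') (Cod C p) \<and>
      f' \<in> Arr C \<and> g' \<in> hom C (Dom C f') (Cod C g') \<and>
      p' \<in> hom C (Cod C f') (Cod C p') \<and> q' \<in> hom C (Cod C g') (Cod C p') \<and>
      p' \<cdot>\<^bsub>C\<^esub> f' = q' \<cdot>\<^bsub>C\<^esub> g' \<and> e \<cdot>\<^bsub>C\<^esub> p' = p \<cdot>\<^bsub>C\<^esub> b \<and> e \<cdot>\<^bsub>C\<^esub> q' = q \<cdot>\<^bsub>C\<^esub> d \<and>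
      is_pullback C a f' f b \<and> is_pullback C a g' g d \<longrightarrow>
      (is_pushout C f' g' p' q' \<longleftrightarrow> is_pullback C b p' p e \<and> is_pullback C d q' q e))"

locale adhesive_category = category +
  assumes has_pullbacks:
      "\<lbrakk>f \<in> Arr C; g \<in> Arr C; Cod C f = Cod C g\<rbrakk> \<Longrightarrow> \<exists>p q. is_pullback C p q f g"
    and has_pushouts_along_monic:
      "\<lbrakk>monic C f; g \<in> Arr C; Dom C f = Dom C g\<rbrakk> \<Longrightarrow> \<exists>p q. is_pushout C f g p q"
    and pushout_along_monic_van_kampen:
      "\<lbrakk>monic C f; is_pushout C f g p q\<rbrakk> \<Longrightarrow> is_van_kampen C f g p q"

locale extensive_category = category +
  assumes has_initial: "\<exists>Z. is_initial C Z"
    and has_coproducts: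
      "\<lbrakk>X \<in> Obj C; Y \<in> Obj C\<rbrakk> \<Longrightarrow> \<exists>a b. is_coproduct C a b \<and> Dom C a = X \<and> Dom C b = Y"
    and has_pullbacks_along_coprojections:
      "\<lbrakk>is_coproduct C a b; h \<in> Arr C; Cod C h = Cod C a\<rbrakk>
        \<Longrightarrow> (\<exists>x f. is_pullback C x f h a) \<and> (\<exists>y g. is_pullback C y g h b)"
    and coproduct_iff_pullbacks:
      "\<lbrakk>is_coproduct C a b; h \<in> hom C Z (Cod C a);
        x \<in> hom C X Z; f \<in> hom C X (Dom C a); h \<cdot> x = a \<cdot> f;
        y \<in> hom C Y Z; g \<in> hom C Y (Dom C b); h \<cdot> y = b \<cdot> g\<rbrakk>
        \<Longrightarrow> is_coproduct C x y \<longleftrightarrow> is_pullback C x f h a \<and> is_pullback C y g h b"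

definition subobject_rel :: "('o, 'a) cat \<Rightarrow> 'o \<Rightarrow> ('a \<times> 'a) set"
  where "subobject_rel C X = {(m, n). monic C m \<and> monic C n \<and> Cod C m = X \<and> Cod C n = X \<and>
    (\<exists>u \<in> hom C (Dom C m) (Dom C n). iso_arr C u \<and> m = n \<cdot>\<^bsub>C\<^esub> u)}"

locale finitary_category = category +
  assumes finite_subobjects:
    "X \<in> Obj C \<Longrightarrow> finite ({m. monic C m \<and> Cod C m = X} // subobject_rel C X)"

locale finitary_adhesive_extensive_category =
  adhesive_category + extensive_category + finitary_category

definition connected_obj :: "('o, 'a) cat \<Rightarrow> 'o \<Rightarrow> bool"
  where "connected_obj C X \<longleftrightarrow> X \<in> Obj C \<and> \<not> is_initial C X \<and>
    (\<forall>a b. is_coproduct C a b \<and> Cod C a = X \<longrightarrow> is_initial C (Dom C a) \<or> is_initial C (Dom C b))"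


section \<open>Linear rules, the rule algebra and its canonical representation\<close>

text \<open>A linear rule \<open>O \<hookleftarrow> K \<hookrightarrow> I\<close> is the pair \<open>(o, i)\<close> of its two legs; it is read from right to
  left, so that \<open>I\<close> is the input and \<open>O\<close> the output.\<close>

type_synonym 'a rule = "'a \<times> 'a"

definition linear_rule :: "('o, 'a) cat \<Rightarrow> 'a rule \<Rightarrow> bool"
  where "linear_rule C r \<longleftrightarrow> monic C (fst r) \<and> monic C (snd r) \<and> Dom C (fst r) = Dom C (snd r)"

definition rule_iso :: "('o, 'a) cat \<Rightarrow> 'a rule \<Rightarrow> 'a rule \<Rightarrow> bool"
  where "rule_iso C r r' \<longleftrightarrow>
    (\<exists>w \<in> hom C (Cod C (fst r)) (Cod C (fst r')).
     \<exists>u \<in> hom C (Dom C (fst r)) (Dom C (fst r')).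
     \<exists>z \<in> hom C (Cod C (snd r)) (Cod C (snd r')).
      iso_arr C w \<and> iso_arr C u \<and> iso_arr C z \<and>
      w \<cdot>\<^bsub>C\<^esub> fst r = fst r' \<cdot>\<^bsub>C\<^esub> u \<and> z \<cdot>\<^bsub>C\<^esub> snd r = snd r' \<cdot>\<^bsub>C\<^esub> u)"

definition rule_class :: "('o, 'a) cat \<Rightarrow> 'a rule \<Rightarrow> 'a rule set"
  where "rule_class C r = {r'. linear_rule C r' \<and> rule_iso C r r'}"

definition rule_classes :: "('o, 'a) cat \<Rightarrow> 'a rule set set"
  where "rule_classes C = rule_class C ` {r. linear_rule C r}"

text \<open>The underlying vector space of the rule algebra is the free real vector space on the
  isomorphism classes of linear rules, with basis vectors \<open>delta C r\<close>. States are the finitely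
  supported real combinations of isomorphism classes of objects. The canonical representation is
  given through its values on the basis \<open>delta C r\<close>; the product of the rule algebra is not needed.\<close>

type_synonym 'a rule_algebra = "'a rule set \<Rightarrow>\<^sub>0 real"
type_synonym 'o state = "'o set \<Rightarrow>\<^sub>0 real"
type_synonym 'o operator = "'o state \<Rightarrow> 'o state"

definition delta :: "('o, 'a) cat \<Rightarrow> 'a rule \<Rightarrow> 'a rule_algebra"
  where "delta C r = Poly_Mapping.single (rule_class C r) 1"

definition obj_class :: "('o, 'a) cat \<Rightarrow> 'o \<Rightarrow> 'o set"
  where "obj_class C X = {Y \<in> Obj C. iso_obj C X Y}"

definition obj_classes :: "('o, 'a) cat \<Rightarrow> 'o set set"
  where "obj_classes C = obj_class C ` Obj C"

definition states :: "('o, 'a) cat \<Rightarrow> 'o state set"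
  where "states C = {v. Poly_Mapping.keys v \<subseteq> obj_classes C}"

definition rep :: "'b set \<Rightarrow> 'b"
  where "rep A = (SOME x. x \<in> A)"

text \<open>Double-pushout rewriting: \<open>m\<close> is an admissible match of \<open>r = (o, i)\<close> in \<open>X\<close> if \<open>m\<close> is monic and
  \<open>i\<close>, \<open>m\<close> have a pushout complement \<open>(d, e)\<close>.\<close>

definition matches :: "('o, 'a) cat \<Rightarrow> 'a rule \<Rightarrow> 'o \<Rightarrow> 'a set"
  where "matches C r X =
    {m \<in> hom C (Cod C (snd r)) X. monic C m \<and> (\<exists>d e. is_pushout C (snd r) d m e)}"

text \<open>In an adhesive category pushout complements of monomorphisms and pushouts are unique up to
  isomorphism, so that the set of all possible results of a rewriting step is exactly one
  isomorphism class of objects.\<close>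

definition rewrite_class :: "('o, 'a) cat \<Rightarrow> 'a rule \<Rightarrow> 'a \<Rightarrow> 'o set"
  where "rewrite_class C r m =
    {Y. \<exists>d e m' e'. is_pushout C (snd r) d m e \<and> is_pushout C (fst r) d m' e' \<and> Y = Cod C m'}"

definition rho :: "('o, 'a) cat \<Rightarrow> 'a rule_algebra \<Rightarrow> 'o operator"
  where "rho C h v =
    (\<Sum>R \<in> Poly_Mapping.keys h \<inter> rule_classes C. \<Sum>X \<in> Poly_Mapping.keys v \<inter> obj_classes C.
      (Poly_Mapping.lookup h R * Poly_Mapping.lookup v X) *\<^sub>R
        (\<Sum>m \<in> matches C (rep R) (rep X). Poly_Mapping.single (rewrite_class C (rep R) m) 1))"

text \<open>The linear extension of
  \<open>\<delta>(O \<hookleftarrow>\<^sub>o K \<hookrightarrow>\<^sub>i I) \<mapsto> \<rho>(\<delta>(I \<hookleftarrow>\<^sub>i K \<hookrightarrow>\<^sub>i I))\<close>.\<close>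

definition obs :: "('o, 'a) cat \<Rightarrow> 'a rule_algebra \<Rightarrow> 'o operator"
  where "obs C h = rho C (\<Sum>R \<in> Poly_Mapping.keys h.
    Poly_Mapping.lookup h R *\<^sub>R delta C (snd (rep R), snd (rep R)))"

definition hamiltonian ::
  "('o, 'a) cat \<Rightarrow> 'j set \<Rightarrow> ('j \<Rightarrow> real) \<Rightarrow> ('j \<Rightarrow> 'a rule_algebra) \<Rightarrow> 'o operator"
  where "hamiltonian C J \<kappa> h = (\<lambda>v. \<Sum>j \<in> J. \<kappa> j *\<^sub>R (rho C (h j) v - obs C (h j) v))"

definition bra :: "'o state \<Rightarrow> real"
  where "bra v = (\<Sum>X \<in> Poly_Mapping.keys v. Poly_Mapping.lookup v X)"

definition ad :: "'o operator \<Rightarrow> 'o operator \<Rightarrow> 'o operator"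
  where "ad A B = (\<lambda>v. A (B v) - B (A v))"


section \<open>Polynomials in observables, jump-closure and moment bisimilarity\<close>

text \<open>A set of observables is given as an injective family indexed by a finite set.\<close>

definition connected_observable :: "('o, 'a) cat \<Rightarrow> 'o operator \<Rightarrow> bool"
  where "connected_observable C A \<longleftrightarrow>
    (\<exists>r. linear_rule C r \<and> connected_obj C (Cod C (snd r)) \<and> A = obs C (delta C r))"

definition connected_observables :: "('o, 'a) cat \<Rightarrow> 'i set \<Rightarrow> ('i \<Rightarrow> 'o operator) \<Rightarrow> bool"
  where "connected_observables C I Ob \<longleftrightarrow>
    finite I \<and> inj_on Ob I \<and> (\<forall>i \<in> I. connected_observable C (Ob i))"

type_synonym 'i multi_index = "'i \<Rightarrow>\<^sub>0 nat"
type_synonym 'i polynomial = "'i multi_index \<Rightarrow>\<^sub>0 real"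

definition polynomial_over :: "'i set \<Rightarrow> 'i polynomial \<Rightarrow> bool"
  where "polynomial_over I P \<longleftrightarrow> (\<forall>n \<in> Poly_Mapping.keys P. Poly_Mapping.keys n \<subseteq> I)"

text \<open>The product \<open>\<Prod>\<^sub>i O\<^sub>i\<^bsup>n\<^sub>i\<^esup>\<close> of operators. It is independent of the order of the factors because
  observables commute.\<close>

definition monomial_op :: "'i set \<Rightarrow> ('i \<Rightarrow> 'o operator) \<Rightarrow> 'i multi_index \<Rightarrow> 'o operator"
  where "monomial_op I Ob n =
    Finite_Set.fold (\<lambda>i A. (Ob i ^^ Poly_Mapping.lookup n i) \<circ> A) id I"

text \<open>\<open>bra_poly I Ob P\<close> is the functional \<open>\<langle>| P(O)\<close>.\<close>

definition bra_poly ::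
  "'i set \<Rightarrow> ('i \<Rightarrow> 'o operator) \<Rightarrow> 'i polynomial \<Rightarrow> 'o state \<Rightarrow> real"
  where "bra_poly I Ob P v =
    (\<Sum>n \<in> Poly_Mapping.keys P. Poly_Mapping.lookup P n * bra (monomial_op I Ob n v))"

definition lin_comb :: "'i set \<Rightarrow> ('i \<Rightarrow> real) \<Rightarrow> ('i \<Rightarrow> 'o operator) \<Rightarrow> 'o operator"
  where "lin_comb I lam Ob = (\<lambda>v. \<Sum>i \<in> I. lam i *\<^sub>R Ob i v)"

definition poly_jump_closed ::
  "('o, 'a) cat \<Rightarrow> 'i set \<Rightarrow> ('i \<Rightarrow> 'o operator) \<Rightarrow> 'o operator \<Rightarrow> bool"
  where "poly_jump_closed C I Ob H \<longleftrightarrow>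
    (\<forall>n lam. \<exists>P. polynomial_over I P \<and>
      (\<forall>v \<in> states C. bra ((ad (lin_comb I lam Ob) ^^ n) H v) = bra_poly I Ob P v))"

text \<open>\<open>S\<close> stands for the formal power series \<open>\<Sum>\<^sub>l \<lambda>\<^sup>l S\<^sub>l(O)\<close> in \<open>\<lambda>\<close> whose coefficients \<open>S\<^sub>l\<close> are
  polynomials in the observables. \<open>conversion_symbol C I Ob H S\<close> says that
  \<open>\<langle>| (exp(ad\<^bsub>\<lambda>\<cdot>O\<^esub>) H) = \<langle>| \<Sum>\<^sub>l \<lambda>\<^sup>l S\<^sub>l(O)\<close> as formal power series in \<open>\<lambda>\<close>: the homogeneous part of
  degree \<open>n\<close> of the left-hand side is \<open>\<langle>| ad\<^bsub>\<lambda>\<cdot>O\<^esub>\<^sup>n H / n!\<close>, and homogeneous polynomials in \<open>\<lambda>\<close> are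
  equal iff they agree for all real values of \<open>\<lambda>\<close>.\<close>

definition conversion_symbol ::
  "('o, 'a) cat \<Rightarrow> 'i set \<Rightarrow> ('i \<Rightarrow> 'o operator) \<Rightarrow> 'o operator
    \<Rightarrow> ('i multi_index \<Rightarrow> 'i polynomial) \<Rightarrow> bool"
  where "conversion_symbol C I Ob H S \<longleftrightarrow>
    (\<forall>l. polynomial_over I (S l)) \<and> (\<forall>l. \<not> Poly_Mapping.keys l \<subseteq> I \<longrightarrow> S l = 0) \<and>
    (\<forall>n lam. \<forall>v \<in> states C.
      bra ((ad (lin_comb I lam Ob) ^^ n) H v) / fact n =
      (\<Sum>l | Poly_Mapping.keys l \<subseteq> I \<and> (\<Sum>i \<in> I. Poly_Mapping.lookup l i) = n.
        (\<Prod>i \<in> I. lam i ^ Poly_Mapping.lookup l i) * bra_poly I Ob (S l) v))"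

text \<open>Formal power series in \<open>\<lambda>\<close> are given by their coefficients. Replacing \<open>O\<^sub>i\<close> by
  \<open>\<partial>/\<partial>\<lambda>\<^sub>i\<close> in \<open>\<langle>| \<Sum>\<^sub>l \<lambda>\<^sup>l S\<^sub>l(O) |\<emptyset>\<rangle>\<close> and using \<open>\<langle>|\<emptyset>\<rangle> = 1\<close> gives the differential
  operator \<open>\<Sum>\<^sub>l \<lambda>\<^sup>l S\<^sub>l(\<partial>/\<partial>\<lambda>)\<close>.\<close>

type_synonym 'i fpseries = "'i multi_index \<Rightarrow> real"

definition fp_deriv :: "'i multi_index \<Rightarrow> 'i fpseries \<Rightarrow> 'i fpseries"
  where "fp_deriv m M = (\<lambda>b. M (b + m) *
    (\<Prod>i \<in> Poly_Mapping.keys m.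
      fact (Poly_Mapping.lookup b i + Poly_Mapping.lookup m i) / fact (Poly_Mapping.lookup b i)))"

definition diff_op ::
  "('i multi_index \<Rightarrow> 'i polynomial) \<Rightarrow> 'i fpseries \<Rightarrow> 'i fpseries"
  where "diff_op S M = (\<lambda>a. \<Sum>(l, b) | l + b = a.
    \<Sum>m \<in> Poly_Mapping.keys (S l). Poly_Mapping.lookup (S l) m * fp_deriv m M b)"

text \<open>In both systems the observables are indexed by \<open>I\<^sub>1\<close>, the second family through \<open>f\<close>, so that both
  evolution operators act on power series in the same variables \<open>\<lambda>\<^sub>i\<close>.\<close>

definition moment_bisimilar ::
  "('o, 'a) cat \<Rightarrow> 'o operator \<Rightarrow> 'i set \<Rightarrow> ('i \<Rightarrow> 'o operator)
    \<Rightarrow> ('p, 'b) cat \<Rightarrow> 'p operator \<Rightarrow> 'k set \<Rightarrow> ('k \<Rightarrow> 'p operator) \<Rightarrow> ('i \<Rightarrow> 'k) \<Rightarrow> bool"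
  where "moment_bisimilar C\<^sub>1 H\<^sub>1 I\<^sub>1 Ob\<^sub>1 C\<^sub>2 H\<^sub>2 I\<^sub>2 Ob\<^sub>2 f \<longleftrightarrow>
    connected_observables C\<^sub>1 I\<^sub>1 Ob\<^sub>1 \<and> poly_jump_closed C\<^sub>1 I\<^sub>1 Ob\<^sub>1 H\<^sub>1 \<and>
    connected_observables C\<^sub>2 I\<^sub>2 Ob\<^sub>2 \<and> poly_jump_closed C\<^sub>2 I\<^sub>2 Ob\<^sub>2 H\<^sub>2 \<and>
    bij_betw f I\<^sub>1 I\<^sub>2 \<and>
    (\<exists>S\<^sub>1 S\<^sub>2. conversion_symbol C\<^sub>1 I\<^sub>1 Ob\<^sub>1 H\<^sub>1 S\<^sub>1 \<and> conversion_symbol C\<^sub>2 I\<^sub>1 (Ob\<^sub>2 \<circ> f) H\<^sub>2 S\<^sub>2 \<and>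
      diff_op S\<^sub>1 = diff_op S\<^sub>2)"

definition s1 :: "nat \<Rightarrow> nat \<Rightarrow> real"
  where "s1 k n = (- 1) ^ (k - n) * real (stirling k n)"

definition s1_multi :: "'i set \<Rightarrow> 'i multi_index \<Rightarrow> 'i multi_index \<Rightarrow> real"
  where "s1_multi I k n = (\<Prod>i \<in> I. s1 (Poly_Mapping.lookup k i) (Poly_Mapping.lookup n i))"


section \<open>Coloured discrete graphs\<close>

text \<open>An edgeless graph with vertices coloured in \<open>Col\<close> is a finite coloured set of vertices. The
  vertices of colour \<open>c\<close> are named \<open>(c, k)\<close>, and a graph is a finite set of such vertices; every finite
  \<open>Col\<close>-coloured set is isomorphic to one of this form.\<close>

type_synonym 'c dgraph = "('c \<times> nat) set"
type_synonym 'c dgraph_map = "'c dgraph \<times> ('c \<times> nat \<Rightarrow> 'c \<times> nat) \<times> 'c dgraph"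

definition discrete_cat :: "'c set \<Rightarrow> ('c dgraph, 'c dgraph_map) cat"
  where "discrete_cat Col = \<lparr>
    Obj = {V. finite V \<and> V \<subseteq> Col \<times> UNIV},
    Arr = {(V, f, W). finite V \<and> V \<subseteq> Col \<times> UNIV \<and> finite W \<and> W \<subseteq> Col \<times> UNIV \<and>
            f \<in> V \<rightarrow>\<^sub>E W \<and> (\<forall>x \<in> V. fst (f x) = fst x)},
    Dom = (\<lambda>(V, f, W). V),
    Cod = (\<lambda>(V, f, W). W),
    Ide = (\<lambda>V. (V, restrict id V, V)),
    Comp = (\<lambda>(V', g, W) (V, f, W'). (V, compose V g f, W))\<rparr>"

definition discrete_graph :: "'c set \<Rightarrow> ('c \<Rightarrow> nat) \<Rightarrow> 'c dgraph"
  where "discrete_graph Col n = {(c, k). c \<in> Col \<and> k < n c}"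

definition empty_map :: "'c dgraph \<Rightarrow> 'c dgraph_map"
  where "empty_map V = ({}, \<lambda>x. undefined, V)"

definition discrete_rule :: "'c set \<Rightarrow> ('c \<Rightarrow> nat) \<Rightarrow> ('c \<Rightarrow> nat) \<Rightarrow> 'c dgraph_map rule"
  where "discrete_rule Col n k =
    (empty_map (discrete_graph Col n), empty_map (discrete_graph Col k))"

definition vertex_count :: "'c set \<Rightarrow> 'c \<Rightarrow> 'c dgraph operator"
  where "vertex_count Col c =
    (let u = Ide (discrete_cat Col) (discrete_graph Col (\<lambda>c'. if c' = c then 1 else 0))
     in obs (discrete_cat Col) (delta (discrete_cat Col) (u, u)))"

end

theory Submission
  imports Defs
begin

text \<open>Observables act diagonally on isomorphism classes, so they commute with each other and with the
  diagonal part of \<open>H\<close>; and a rule and its observable have equally many matches, so \<open>\<langle>| H = 0\<close>. Hence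
  only the jump part contributes, and \<open>ad\<^bsub>\<lambda>\<cdot>O\<^esub>\<close> multiplies \<open>\<rho>(h\<^sub>j)\<close> by \<open>\<lambda> \<cdot> \<eta>\<^sub>j\<close>. By (ii) the conversion symbol is
  the expansion of \<open>\<Sum>\<^sub>j \<kappa>\<^sub>j \<alpha>\<^sub>j (exp(\<lambda> \<cdot> \<eta>\<^sub>j) - 1) \<Sum>\<^sub>n s\<^sub>1(k\<^sub>j, n) x\<^sup>n\<close>, which depends on the numerical data only.
  A discrete rule consumes \<open>k\<close> and creates \<open>\<eta> + k\<close> vertices of each colour, so it shifts the vertex counts
  by \<open>\<eta>\<close>, and its matches, i.e. the embeddings of its input, are counted by falling factorials
  \<open>\<Sum>\<^sub>n s\<^sub>1(k, n) x\<^sup>n\<close>. So it satisfies (i) and (ii) with the same data and \<open>\<alpha> = 1\<close>.\<close>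

section \<open>Formal power series of commutators\<close>

text \<open>Bisimilarity asks for some pair of conversion symbols with equal differential operators.
  One and the same symbol is used for both systems, so equality of the evolution equations is
  reflexivity and no uniqueness of symbols enters. This works because rates enter only through the
  products \<open>\<alpha> j * \<kappa> j\<close>: the discrete system has them as its rates, the
  given one splits them into rate and jump prefactor. The obstacle is that \<open>rho\<close> and
  \<open>obs\<close> are defined through chosen representatives of classes, and that the result of a
  step is the set of all objects reachable through any pushout complement. Match counts and results
  are therefore shown invariant under isomorphism of rules. For discrete graphs, universal
  properties also have to be turned into numbers: a pushout under the empty graph is a disjoint
  union, colour counts determine a graph up to isomorphism, and a rewriting step becomes an identity
  between counts.\<close>

lemma lookup_scaleR [simp]:
  fixes v :: "'x \<Rightarrow>\<^sub>0 'b::real_vector"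
  shows "Poly_Mapping.lookup (c *\<^sub>R v) x = c *\<^sub>R Poly_Mapping.lookup v x"
proof -
  have "finite {x. c *\<^sub>R Poly_Mapping.lookup v x \<noteq> 0}"
    by (rule finite_subset[OF _ finite_lookup[of v]]) auto
  then show ?thesis
    by (simp add: scaleR_poly_mapping_def)
qed

text \<open>Basis vectors outside A are sent to 0, as \<open>rho\<close> does with keys that are not
  isomorphism classes. The same construction yields \<open>bra\<close> and, for a fixed state,
  \<open>bra_poly\<close>, so linearity is proved once.\<close>

definition lin_ext :: "'x set \<Rightarrow> ('x \<Rightarrow> 'b::real_vector) \<Rightarrow> ('x \<Rightarrow>\<^sub>0 real) \<Rightarrow> 'b"
  where "lin_ext A T v = (\<Sum>X \<in> Poly_Mapping.keys v \<inter> A. Poly_Mapping.lookup v X *\<^sub>R T X)"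

text \<open>The supports of v, w and v + w differ; over a common finite superset the sums share one
  index set, because the additional terms have coefficient 0.\<close>

lemma lin_ext_superset:
  assumes "finite S" "Poly_Mapping.keys v \<subseteq> S"
  shows "lin_ext A T v = (\<Sum>X \<in> S \<inter> A. Poly_Mapping.lookup v X *\<^sub>R T X)"
  unfolding lin_ext_def using assms
  by (intro sum.mono_neutral_left) (auto simp: in_keys_iff)

lemma linear_lin_ext: "linear (lin_ext A T)"
proof
  fix v w :: "'a \<Rightarrow>\<^sub>0 real" and c :: real
  let ?S = "Poly_Mapping.keys v \<union> Poly_Mapping.keys w"
  have "lin_ext A T u = (\<Sum>X \<in> ?S \<inter> A. Poly_Mapping.lookup u X *\<^sub>R T X)"
    if "Poly_Mapping.keys u \<subseteq> ?S" for u
    using that by (intro lin_ext_superset) auto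
  from this[of v] this[of w] this[of "v + w"] show "lin_ext A T (v + w) = lin_ext A T v + lin_ext A T w"
    using keys_add[of v w] by (auto simp: lookup_add scaleR_add_left sum.distrib)
  have "lin_ext A T (c *\<^sub>R v) = (\<Sum>X \<in> Poly_Mapping.keys v \<inter> A. Poly_Mapping.lookup (c *\<^sub>R v) X *\<^sub>R T X)"
    by (intro lin_ext_superset) (auto simp: in_keys_iff)
  then show "lin_ext A T (c *\<^sub>R v) = c *\<^sub>R lin_ext A T v"
    by (simp add: lin_ext_def scaleR_sum_right)
qed

lemma lin_ext_single [simp]:
  "lin_ext A T (Poly_Mapping.single X c) = (if X \<in> A then c *\<^sub>R T X else 0)"
  by (cases "c = 0") (auto simp: lin_ext_def)

text \<open>With observables in this coefficientwise form, their powers and products are powers and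
  products of real numbers.\<close>

lemma lin_ext_diagonal_lookup:
  "Poly_Mapping.lookup (lin_ext A (\<lambda>X. a X *\<^sub>R Poly_Mapping.single X 1) v) X =
    (if X \<in> A then a X * Poly_Mapping.lookup v X else 0)"
proof -
  have "Poly_Mapping.lookup (lin_ext A (\<lambda>X. a X *\<^sub>R Poly_Mapping.single X (1::real)) v) X =
      (\<Sum>Y \<in> Poly_Mapping.keys v \<inter> A. if Y = X then a X * Poly_Mapping.lookup v X else 0)"
    unfolding lin_ext_def lookup_sum by (intro sum.cong) (auto simp: lookup_single)
  also have "\<dots> = (if X \<in> A then a X * Poly_Mapping.lookup v X else 0)"
    by (auto simp: in_keys_iff)
  finally show ?thesis .
qed

lemma bra_eq_lin_ext: "bra = lin_ext UNIV (\<lambda>_. 1)"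
  by (auto simp: bra_def lin_ext_def)

lemma linear_bra: "linear bra"
  by (simp only: bra_eq_lin_ext linear_lin_ext)

lemma bra_single [simp]: "bra (Poly_Mapping.single X c) = c"
  by (simp add: bra_eq_lin_ext)

lemma poly_mapping_eq_sum_single:
  fixes v :: "'x \<Rightarrow>\<^sub>0 real"
  shows "v = (\<Sum>X \<in> Poly_Mapping.keys v. Poly_Mapping.lookup v X *\<^sub>R Poly_Mapping.single X 1)"
proof (rule poly_mapping_eqI)
  fix X
  have "Poly_Mapping.lookup (\<Sum>X \<in> Poly_Mapping.keys v. Poly_Mapping.lookup v X *\<^sub>R Poly_Mapping.single X (1::real)) X =
      (\<Sum>Y \<in> Poly_Mapping.keys v. if Y = X then Poly_Mapping.lookup v X else 0)"
    unfolding lookup_sum by (intro sum.cong) (auto simp: lookup_single)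
  then show "Poly_Mapping.lookup v X =
      Poly_Mapping.lookup (\<Sum>X \<in> Poly_Mapping.keys v. Poly_Mapping.lookup v X *\<^sub>R Poly_Mapping.single X (1::real)) X"
    by (auto simp: in_keys_iff)
qed

lemma subspace_states: "subspace (states C)"
proof (rule subspaceI)
  show "x + y \<in> states C" if "x \<in> states C" "y \<in> states C" for x y
    using that keys_add[of x y] by (auto simp: states_def)
  show "c *\<^sub>R x \<in> states C" if "x \<in> states C" for c x
    using that by (auto simp: states_def in_keys_iff subset_iff)
qed (simp add: states_def)

lemma linear_eq_on_states:
  assumes "linear f" "linear g" "v \<in> states C"
    and eq: "\<And>X. X \<in> obj_classes C \<Longrightarrow> f (Poly_Mapping.single X 1) = g (Poly_Mapping.single X 1)"
  shows "f v = g v"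
proof -
  have *: "l v = (\<Sum>X \<in> Poly_Mapping.keys v. Poly_Mapping.lookup v X *\<^sub>R l (Poly_Mapping.single X 1))"
    if "linear l" for l :: "'a state \<Rightarrow> 'b"
    by (subst poly_mapping_eq_sum_single) (simp only: linear_sum[OF that] linear_scale[OF that])
  show ?thesis
    unfolding *[OF assms(1)] *[OF assms(2)]
    using assms(3) eq by (intro sum.cong) (auto simp: states_def)
qed

text \<open>Each \<open>R j\<close> is an eigenvector of all \<open>ad (Ob i)\<close>, hence of
  \<open>ad\<close> of their linear combination, with eigenvalue
  \<open>\<Sum>i \<in> I. lam i * e i j\<close>; each \<open>D j\<close> lies in the kernel, and
  \<open>0 ^ n\<close> keeps it at n = 0 only. The eigenvalue equations hold on
  \<open>states C\<close>, which is why the induction ranges over all states v.\<close>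

lemma ad_power_hamiltonian:
  fixes Ob :: "'i \<Rightarrow> 'o operator" and R D :: "'j \<Rightarrow> 'o operator" and e :: "'i \<Rightarrow> 'j \<Rightarrow> real"
  assumes Ob_linear: "\<And>i. i \<in> I \<Longrightarrow> linear (Ob i)"
    and Ob_states: "\<And>i v. i \<in> I \<Longrightarrow> v \<in> states C \<Longrightarrow> Ob i v \<in> states C"
    and R_linear: "\<And>j. j \<in> J \<Longrightarrow> linear (R j)" and D_linear: "\<And>j. j \<in> J \<Longrightarrow> linear (D j)"
    and ad_R: "\<And>i j v. \<lbrakk>i \<in> I; j \<in> J; v \<in> states C\<rbrakk> \<Longrightarrow> ad (Ob i) (R j) v = e i j *\<^sub>R R j v"
    and ad_D: "\<And>i j v. \<lbrakk>i \<in> I; j \<in> J; v \<in> states C\<rbrakk> \<Longrightarrow> ad (Ob i) (D j) v = 0"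
    and v: "v \<in> states C"
  shows "(ad (lin_comb I lam Ob) ^^ n) (\<lambda>v. \<Sum>j \<in> J. \<kappa> j *\<^sub>R (R j v - D j v)) v =
    (\<Sum>j \<in> J. \<kappa> j *\<^sub>R ((\<Sum>i \<in> I. lam i * e i j) ^ n *\<^sub>R R j v - 0 ^ n *\<^sub>R D j v))"
  using v
proof (induction n arbitrary: v)
  case (Suc n)
  let ?A = "lin_comb I lam Ob" and ?c = "\<lambda>j. \<Sum>i \<in> I. lam i * e i j"
  have A: "linear ?A"
    unfolding lin_comb_def
    by (intro linear_compose_sum ballI linear_compose_scale_right Ob_linear)
  \<comment> \<open>The commutator evaluates its operator at \<open>?A v\<close> too, so the
    induction hypothesis is needed there as well.\<close>
  have Av: "?A v \<in> states C"
    unfolding lin_comb_def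
    by (intro subspace_sum[OF subspace_states] subspace_scale[OF subspace_states] Ob_states Suc.prems)
  have lin_B: "?A (B v) - B (?A v) = (\<Sum>i \<in> I. lam i *\<^sub>R ad (Ob i) B v)" if "linear B" for B
    by (simp add: lin_comb_def ad_def linear_sum[OF that] linear_scale[OF that]
        scaleR_diff_right sum_subtractf)
  have R: "?A (R j v) - R j (?A v) = ?c j *\<^sub>R R j v" if "j \<in> J" for j
    using that Suc.prems by (simp add: lin_B R_linear ad_R scaleR_sum_left)
  have D: "?A (D j v) - D j (?A v) = 0" if "j \<in> J" for j
    using that Suc.prems by (simp add: lin_B D_linear ad_D)
  have "(ad ?A ^^ Suc n) (\<lambda>v. \<Sum>j \<in> J. \<kappa> j *\<^sub>R (R j v - D j v)) v =
      (\<Sum>j \<in> J. \<kappa> j *\<^sub>R (?c j ^ n *\<^sub>R (?A (R j v) - R j (?A v)) - 0 ^ n *\<^sub>R (?A (D j v) - D j (?A v))))"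
    unfolding funpow.simps o_apply ad_def[of ?A] Suc.IH[OF Suc.prems] Suc.IH[OF Av] linear_sum[OF A]
      linear_scale[OF A] linear_diff[OF A] sum_subtractf[symmetric]
    by (intro sum.cong refl) (simp add: algebra_simps)
  also have "\<dots> = (\<Sum>j \<in> J. \<kappa> j *\<^sub>R (?c j ^ Suc n *\<^sub>R R j v - 0 ^ Suc n *\<^sub>R D j v))"
    by (intro sum.cong refl) (simp add: R D mult.commute)
  finally show ?case .
qed simp

section \<open>Multi-indices and the multinomial formula\<close>

lemma keys_multi_index_le:
  fixes k n :: "'i \<Rightarrow>\<^sub>0 nat"
  assumes "\<forall>i. Poly_Mapping.lookup n i \<le> Poly_Mapping.lookup k i"
  shows "Poly_Mapping.keys n \<subseteq> Poly_Mapping.keys k"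
proof
  fix i assume "i \<in> Poly_Mapping.keys n"
  then show "i \<in> Poly_Mapping.keys k"
    using assms[rule_format, of i] by (auto simp: in_keys_iff)
qed

text \<open>The index set of the degree n part in \<open>conversion_symbol\<close>. The support
  condition keeps it finite for finite I, since the sum over I does not see exponents
  elsewhere.\<close>

definition multi_indices :: "'i set \<Rightarrow> nat \<Rightarrow> 'i multi_index set"
  where "multi_indices I n =
    {l. Poly_Mapping.keys l \<subseteq> I \<and> (\<Sum>i \<in> I. Poly_Mapping.lookup l i) = n}"

lemma finite_multi_indices:
  assumes "finite I"
  shows "finite (multi_indices I n)"
proof (rule inj_on_finite)
  show "inj_on (\<lambda>l. restrict (Poly_Mapping.lookup l) I) (multi_indices I n)"
  proof (rule inj_onI, rule poly_mapping_eqI)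
    fix l m i assume "l \<in> multi_indices I n" "m \<in> multi_indices I n"
      and eq: "restrict (Poly_Mapping.lookup l) I = restrict (Poly_Mapping.lookup m) I"
    then have "i \<notin> I \<Longrightarrow> Poly_Mapping.lookup l i = 0 \<and> Poly_Mapping.lookup m i = 0"
      by (auto simp: multi_indices_def in_keys_iff subset_iff)
    then show "Poly_Mapping.lookup l i = Poly_Mapping.lookup m i"
      using fun_cong[OF eq, of i] by (cases "i \<in> I") auto
  qed
  show "(\<lambda>l. restrict (Poly_Mapping.lookup l) I) ` multi_indices I n \<subseteq> (\<Pi>\<^sub>E i \<in> I. {..n})"
    using assms by (auto simp: multi_indices_def intro: member_le_sum)
  show "finite (\<Pi>\<^sub>E i \<in> I. {..n})"
    using assms by (intro finite_PiE) auto
qed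

text \<open>Splitting off the exponent m of the new variable j leaves degree n - m over I: the
  bookkeeping of a Cauchy product.\<close>

lemma multi_indices_insert:
  fixes n :: nat
  assumes "finite I" "j \<notin> I"
  shows "bij_betw (\<lambda>(m, l). l + Poly_Mapping.single j m)
    (SIGMA m:{..n}. multi_indices I (n - m)) (multi_indices (insert j I) n)"
proof (rule bij_betw_byWitness[where f' = "\<lambda>l. (Poly_Mapping.lookup l j, l - Poly_Mapping.single j (Poly_Mapping.lookup l j))"])
  have 0: "Poly_Mapping.lookup l j = 0" if "l \<in> multi_indices I m" for l m
    using that assms by (auto simp: multi_indices_def in_keys_iff subset_iff)
  have *: "(\<Sum>i \<in> I. Poly_Mapping.lookup (l :: 'a \<Rightarrow>\<^sub>0 nat) i + Poly_Mapping.lookup (Poly_Mapping.single j m) i) = (\<Sum>i \<in> I. Poly_Mapping.lookup l i)" for l m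
    using assms by (intro sum.cong) (auto simp: lookup_single when_def)
  have **: "(\<Sum>i \<in> I. Poly_Mapping.lookup (l :: 'a \<Rightarrow>\<^sub>0 nat) i - Poly_Mapping.lookup (Poly_Mapping.single j m) i) = (\<Sum>i \<in> I. Poly_Mapping.lookup l i)" for l m
    using assms by (intro sum.cong) (auto simp: lookup_single when_def)
  show "\<forall>a \<in> SIGMA m:{..n}. multi_indices I (n - m).
      (\<lambda>l. (Poly_Mapping.lookup l j, l - Poly_Mapping.single j (Poly_Mapping.lookup l j)))
        ((\<lambda>(m, l). l + Poly_Mapping.single j m) a) = a"
    by (auto simp: lookup_add 0)
  show "\<forall>l \<in> multi_indices (insert j I) n. (\<lambda>(m, l). l + Poly_Mapping.single j m)
      ((\<lambda>l. (Poly_Mapping.lookup l j, l - Poly_Mapping.single j (Poly_Mapping.lookup l j))) l) = l"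
    by (auto intro!: poly_mapping_eqI simp: lookup_add lookup_minus lookup_single when_def)
  show "(\<lambda>(m, l). l + Poly_Mapping.single j m) ` (SIGMA m:{..n}. multi_indices I (n - m)) \<subseteq> multi_indices (insert j I) n"
    using assms 0 *
    by (auto simp: multi_indices_def in_keys_iff subset_iff lookup_add lookup_single when_def split: if_splits)
  show "(\<lambda>l. (Poly_Mapping.lookup l j, l - Poly_Mapping.single j (Poly_Mapping.lookup l j))) ` multi_indices (insert j I) n
      \<subseteq> (SIGMA m:{..n}. multi_indices I (n - m))"
    using assms **
    by (auto simp: multi_indices_def in_keys_iff subset_iff lookup_minus lookup_single when_def split: if_splits)
      metis
qed

text \<open>In divided powers the multinomial coefficients disappear, and adding a variable is the
  multiplicativity of the exponential series. The reciprocal factorials become the Taylor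
  coefficients in \<open>evolution_symbol\<close>.\<close>

lemma multinomial_expansion:
  fixes x :: "'i \<Rightarrow> real"
  assumes "finite I"
  shows "(\<Sum>i \<in> I. x i) ^ n / fact n =
    (\<Sum>l \<in> multi_indices I n. \<Prod>i \<in> I. x i ^ Poly_Mapping.lookup l i / fact (Poly_Mapping.lookup l i))"
  using assms
proof (induction I arbitrary: n rule: finite_induct)
  case empty
  then show ?case by (cases n) (auto simp: multi_indices_def)
next
  case (insert j I)
  let ?t = "\<lambda>i l. x i ^ Poly_Mapping.lookup l i / fact (Poly_Mapping.lookup l i)"
  have 0: "Poly_Mapping.lookup l j = 0" if "l \<in> multi_indices I m" for l m
    using that insert.hyps by (auto simp: multi_indices_def in_keys_iff subset_iff)
  have j: "Poly_Mapping.lookup (l + Poly_Mapping.single j m) j = m" if "l \<in> multi_indices I p" for l m p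
    using 0[OF that] by (simp add: lookup_add)
  have I: "(\<Prod>i \<in> I. ?t i (l + Poly_Mapping.single j m)) = (\<Prod>i \<in> I. ?t i l)" for l m
    using insert.hyps by (intro prod.cong) (auto simp: lookup_add lookup_single when_def)
  have "(\<Sum>i \<in> insert j I. x i) ^ n / fact n = (\<Sum>m\<le>n. (x j ^ m / fact m) * ((\<Sum>i \<in> I. x i) ^ (n - m) / fact (n - m)))"
    using exp_series_add_commuting[of "x j" "\<Sum>i \<in> I. x i" n] insert.hyps
    by (simp add: divide_inverse mult_ac)
  also have "\<dots> = (\<Sum>m\<le>n. \<Sum>l \<in> multi_indices I (n - m). (x j ^ m / fact m) * (\<Prod>i \<in> I. ?t i l))"
    by (simp add: insert.IH sum_distrib_left)
  also have "\<dots> = (\<Sum>(m, l) \<in> (SIGMA m:{..n}. multi_indices I (n - m)). (x j ^ m / fact m) * (\<Prod>i \<in> I. ?t i l))"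
    by (intro sum.Sigma) (auto simp: finite_multi_indices insert.hyps)
  also have "\<dots> = (\<Sum>a \<in> (SIGMA m:{..n}. multi_indices I (n - m)).
      \<Prod>i \<in> insert j I. ?t i ((\<lambda>(m, l). l + Poly_Mapping.single j m) a))"
    using insert.hyps by (intro sum.cong) (auto simp: j I)
  also have "\<dots> = (\<Sum>l \<in> multi_indices (insert j I) n. \<Prod>i \<in> insert j I. ?t i l)"
    by (intro sum.reindex_bij_betw multi_indices_insert insert.hyps)
  finally show ?case .
qed

section \<open>Polynomials in the observables and the evolution symbol\<close>

lemma bra_poly_eq_lin_ext:
  "bra_poly I Ob P v = lin_ext UNIV (\<lambda>n. bra (monomial_op I Ob n v)) P"
  by (simp add: bra_poly_def lin_ext_def)

lemma subspace_polynomial_over: "subspace {P. polynomial_over I P}"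
proof (rule subspaceI)
  show "x + y \<in> {P. polynomial_over I P}" if "x \<in> {P. polynomial_over I P}" "y \<in> {P. polynomial_over I P}" for x y
    using that keys_add[of x y] by (auto simp: polynomial_over_def)
  show "c *\<^sub>R x \<in> {P. polynomial_over I P}" if "x \<in> {P. polynomial_over I P}" for c x
    using that by (auto simp: polynomial_over_def in_keys_iff)
qed (simp add: polynomial_over_def)

text \<open>For k supported in I this is the product over i of x_i (x_i - 1) ... (x_i - k_i + 1),
  expanded in monomials: the polynomial of hypothesis (ii), evaluated by
  \<open>sum_s1_multi_powers\<close>.\<close>

definition jump_poly :: "'i set \<Rightarrow> 'i multi_index \<Rightarrow> 'i polynomial"
  where "jump_poly I k = (\<Sum>n | \<forall>i. Poly_Mapping.lookup n i \<le> Poly_Mapping.lookup k i.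
    s1_multi I k n *\<^sub>R Poly_Mapping.single n 1)"

lemma polynomial_over_jump_poly:
  assumes "Poly_Mapping.keys k \<subseteq> I"
  shows "polynomial_over I (jump_poly I k)"
proof -
  have "jump_poly I k \<in> {P. polynomial_over I P}"
    unfolding jump_poly_def
  proof (intro subspace_sum[OF subspace_polynomial_over] subspace_scale[OF subspace_polynomial_over])
    fix n assume "n \<in> {n. \<forall>i. Poly_Mapping.lookup n i \<le> Poly_Mapping.lookup k i}"
    then have "Poly_Mapping.keys n \<subseteq> Poly_Mapping.keys k"
      by (intro keys_multi_index_le) auto
    then show "Poly_Mapping.single n 1 \<in> {P. polynomial_over I P}"
      using assms by (auto simp: polynomial_over_def)
  qed
  then show ?thesis by simp
qed

lemma bra_poly_jump_poly:
  "bra_poly I Ob (jump_poly I k) v = (\<Sum>n | \<forall>i. Poly_Mapping.lookup n i \<le> Poly_Mapping.lookup k i.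
    s1_multi I k n * bra (monomial_op I Ob n v))"
  by (simp add: bra_poly_eq_lin_ext jump_poly_def linear_sum[OF linear_lin_ext] linear_scale[OF linear_lin_ext])

text \<open>The Taylor coefficient of index l of the sum over j of \<open>c j\<close> (exp(\<lambda>
  \<cdot> e_j) - 1) times \<open>jump_poly I (k j)\<close>. Excluding l = 0 accounts for the
  subtracted 1; supports outside I get 0 because \<open>conversion_symbol\<close> demands
  it.\<close>

definition evolution_symbol ::
  "'i set \<Rightarrow> 'j set \<Rightarrow> ('j \<Rightarrow> real) \<Rightarrow> ('i \<Rightarrow> 'j \<Rightarrow> real) \<Rightarrow> ('j \<Rightarrow> 'i multi_index)
    \<Rightarrow> 'i multi_index \<Rightarrow> 'i polynomial"
  where "evolution_symbol I J c e k l =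
    (if Poly_Mapping.keys l \<subseteq> I \<and> l \<noteq> 0
     then \<Sum>j \<in> J. (c j * (\<Prod>i \<in> I. e i j ^ Poly_Mapping.lookup l i / fact (Poly_Mapping.lookup l i))) *\<^sub>R
       jump_poly I (k j)
     else 0)"

lemma multi_indices_0: "finite I \<Longrightarrow> multi_indices I 0 = {0}"
  by (auto simp: multi_indices_def in_keys_iff subset_iff intro!: poly_mapping_eqI)

text \<open>Stated for abstract jump operators \<open>R\<close> and diagonal operators
  \<open>D\<close>, with \<open>c\<close> standing for rate times jump prefactor. Keeping that
  product in one piece lets the two systems arrive at literally the same symbol.\<close>

lemma conversion_symbol_evolution_symbol:
  fixes Ob :: "'i \<Rightarrow> 'o operator" and R D :: "'j \<Rightarrow> 'o operator" and e :: "'i \<Rightarrow> 'j \<Rightarrow> real"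
  assumes I: "finite I"
    and Ob_linear: "\<And>i. i \<in> I \<Longrightarrow> linear (Ob i)"
    and Ob_states: "\<And>i v. i \<in> I \<Longrightarrow> v \<in> states C \<Longrightarrow> Ob i v \<in> states C"
    and R_linear: "\<And>j. j \<in> J \<Longrightarrow> linear (R j)" and D_linear: "\<And>j. j \<in> J \<Longrightarrow> linear (D j)"
    and ad_R: "\<And>i j v. \<lbrakk>i \<in> I; j \<in> J; v \<in> states C\<rbrakk> \<Longrightarrow> ad (Ob i) (R j) v = e i j *\<^sub>R R j v"
    and ad_D: "\<And>i j v. \<lbrakk>i \<in> I; j \<in> J; v \<in> states C\<rbrakk> \<Longrightarrow> ad (Ob i) (D j) v = 0"
    and bra_R_D: "\<And>j v. j \<in> J \<Longrightarrow> v \<in> states C \<Longrightarrow> bra (R j v) = bra (D j v)"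
    and k: "\<And>j. j \<in> J \<Longrightarrow> Poly_Mapping.keys (k j) \<subseteq> I"
    and bra_R: "\<And>j v. \<lbrakk>j \<in> J; v \<in> states C\<rbrakk>
      \<Longrightarrow> \<kappa> j * bra (R j v) = c j * bra_poly I Ob (jump_poly I (k j)) v"
    and H: "H = (\<lambda>v. \<Sum>j \<in> J. \<kappa> j *\<^sub>R (R j v - D j v))"
  shows "conversion_symbol C I Ob H (evolution_symbol I J c e k)" (is "conversion_symbol C I Ob H ?S")
  unfolding conversion_symbol_def
proof (intro conjI allI ballI impI)
  fix l
  have "?S l \<in> {P. polynomial_over I P}"
    using k by (auto simp: evolution_symbol_def
        intro!: subspace_sum[OF subspace_polynomial_over, simplified mem_Collect_eq]
          subspace_scale[OF subspace_polynomial_over, simplified mem_Collect_eq] polynomial_over_jump_poly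
          subspace_0[OF subspace_polynomial_over, simplified mem_Collect_eq])
  then show "polynomial_over I (?S l)" by simp
next
  fix n lam v assume v: "v \<in> states C"
  let ?P = "\<lambda>j. bra_poly I Ob (jump_poly I (k j)) v"
  have lhs: "bra ((ad (lin_comb I lam Ob) ^^ n) H v) =
      (\<Sum>j \<in> J. \<kappa> j * ((\<Sum>i \<in> I. lam i * e i j) ^ n * bra (R j v) - 0 ^ n * bra (D j v)))"
    unfolding H
    by (subst ad_power_hamiltonian[where e = e, OF Ob_linear Ob_states R_linear D_linear ad_R ad_D v])
      (simp_all add: linear_sum[OF linear_bra] linear_scale[OF linear_bra] linear_diff[OF linear_bra])
  have "bra ((ad (lin_comb I lam Ob) ^^ n) H v) / fact n =
    (\<Sum>l \<in> multi_indices I n. (\<Prod>i \<in> I. lam i ^ Poly_Mapping.lookup l i) * bra_poly I Ob (?S l) v)"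
  \<comment> \<open>In degree 0 the jump and diagonal parts cancel under \<open>bra\<close>, and the
    only multi-index is 0, where the symbol vanishes. In positive degree \<open>0 ^ n\<close>
    removes the diagonal part.\<close>
  proof (cases "n = 0")
    case True
    then show ?thesis
      using v lhs by (simp add: bra_R_D multi_indices_0 I evolution_symbol_def bra_poly_def)
  next
    case False
    then have l: "l \<noteq> 0" "Poly_Mapping.keys l \<subseteq> I" if "l \<in> multi_indices I n" for l
      using that by (auto simp: multi_indices_def)
    have "bra ((ad (lin_comb I lam Ob) ^^ n) H v) / fact n =
        (\<Sum>j \<in> J. (\<Sum>i \<in> I. lam i * e i j) ^ n * (\<kappa> j * bra (R j v))) / fact n"
      using False by (simp add: lhs power_0_left mult_ac)
    also have "\<dots> = (\<Sum>j \<in> J. ((\<Sum>i \<in> I. lam i * e i j) ^ n / fact n) * (c j * ?P j))"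
      using v by (simp add: bra_R sum_divide_distrib)
    \<comment> \<open>The expansion separates the powers of \<open>lam\<close> from the
      coefficients; exchanging the sums then collects the coefficients over j into the
      symbol.\<close>
    also have "\<dots> = (\<Sum>j \<in> J. \<Sum>l \<in> multi_indices I n. (\<Prod>i \<in> I. lam i ^ Poly_Mapping.lookup l i) *
        (c j * (\<Prod>i \<in> I. e i j ^ Poly_Mapping.lookup l i / fact (Poly_Mapping.lookup l i)) * ?P j))"
      by (simp only: multinomial_expansion[OF I] sum_distrib_right)
        (simp add: power_mult_distrib prod.distrib prod_dividef mult_ac)
    also have "\<dots> = (\<Sum>l \<in> multi_indices I n. (\<Prod>i \<in> I. lam i ^ Poly_Mapping.lookup l i) *
        (\<Sum>j \<in> J. c j * (\<Prod>i \<in> I. e i j ^ Poly_Mapping.lookup l i / fact (Poly_Mapping.lookup l i)) * ?P j))"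
      by (subst sum.swap) (simp add: sum_distrib_left)
    also have "\<dots> = (\<Sum>l \<in> multi_indices I n. (\<Prod>i \<in> I. lam i ^ Poly_Mapping.lookup l i) * bra_poly I Ob (?S l) v)"
      by (intro sum.cong refl)
        (simp add: l evolution_symbol_def bra_poly_eq_lin_ext linear_sum[OF linear_lin_ext] linear_scale[OF linear_lin_ext])
    finally show ?thesis .
  qed
  then show "bra ((ad (lin_comb I lam Ob) ^^ n) H v) / fact n =
      (\<Sum>l | Poly_Mapping.keys l \<subseteq> I \<and> (\<Sum>i \<in> I. Poly_Mapping.lookup l i) = n.
        (\<Prod>i \<in> I. lam i ^ Poly_Mapping.lookup l i) * bra_poly I Ob (?S l) v)"
    by (simp add: multi_indices_def)
qed (simp add: evolution_symbol_def)

text \<open>For a fixed \<open>lam\<close> its powers are mere numbers, so the degree n part of the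
  symbol collapses to one polynomial; \<open>fact n\<close> undoes the division in
  \<open>conversion_symbol\<close>. This supplies jump-closure of the discrete system.\<close>

lemma conversion_symbol_imp_poly_jump_closed:
  assumes "conversion_symbol C I Ob H S"
  shows "poly_jump_closed C I Ob H"
  unfolding poly_jump_closed_def
proof (intro allI)
  fix n lam
  let ?P = "\<Sum>l \<in> multi_indices I n. (fact n * (\<Prod>i \<in> I. lam i ^ Poly_Mapping.lookup l i)) *\<^sub>R S l"
  have "?P \<in> {P. polynomial_over I P}"
    using assms
    by (intro subspace_sum[OF subspace_polynomial_over] subspace_scale[OF subspace_polynomial_over])
      (simp add: conversion_symbol_def)
  moreover have "bra ((ad (lin_comb I lam Ob) ^^ n) H v) = bra_poly I Ob ?P v" if "v \<in> states C" for v
  proof -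
    have "bra ((ad (lin_comb I lam Ob) ^^ n) H v) / fact n =
        (\<Sum>l \<in> multi_indices I n. (\<Prod>i \<in> I. lam i ^ Poly_Mapping.lookup l i) * bra_poly I Ob (S l) v)"
      using assms that by (simp add: conversion_symbol_def multi_indices_def)
    then show ?thesis
      by (simp add: bra_poly_eq_lin_ext linear_sum[OF linear_lin_ext] linear_scale[OF linear_lin_ext]
          field_simps sum_distrib_left)
  qed
  ultimately show "\<exists>P. polynomial_over I P \<and>
      (\<forall>v \<in> states C. bra ((ad (lin_comb I lam Ob) ^^ n) H v) = bra_poly I Ob P v)"
    by auto
qed

section \<open>Rewriting up to isomorphism\<close>

context category
begin

section \<open>Typed arrows, isomorphisms and representatives of classes\<close>

lemma homD:
  assumes "f \<in> hom C X Y"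
  shows "f \<in> Arr C" "Dom C f = X" "Cod C f = Y"
  using assms by (auto simp: hom_def)

text \<open>Typing as equations between \<open>Dom\<close> and \<open>Cod\<close> can be discharged
  by rewriting; the \<open>hom\<close> form leaves endpoints to be guessed.\<close>

lemma Comp_Arr:
  assumes "f \<in> Arr C" "g \<in> Arr C" "Cod C f = Dom C g"
  shows "g \<cdot> f \<in> Arr C" "Dom C (g \<cdot> f) = Dom C f" "Cod C (g \<cdot> f) = Cod C g"
  using Comp_hom[of f "Dom C f" "Dom C g" g "Cod C g"] assms by (auto simp: hom_def)

lemma Comp_assoc_Arr:
  assumes "f \<in> Arr C" "g \<in> Arr C" "k \<in> Arr C" "Cod C f = Dom C g" "Cod C g = Dom C k"
  shows "(k \<cdot> g) \<cdot> f = k \<cdot> (g \<cdot> f)"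
  using Comp_assoc[of f "Dom C f" "Dom C g" g "Dom C k" k "Cod C k"] assms by (auto simp: hom_def)

lemma Comp_Ide_Arr:
  assumes "f \<in> Arr C"
  shows "Cod C f = X \<Longrightarrow> Ide C X \<cdot> f = f" "Dom C f = X \<Longrightarrow> f \<cdot> Ide C X = f"
  using Comp_Ide_left[of f "Dom C f" "Cod C f"] Comp_Ide_right[of f "Dom C f" "Cod C f"] assms
  by (auto simp: hom_def)

lemma Ide_Arr:
  assumes "X \<in> Obj C"
  shows "Ide C X \<in> Arr C" "Dom C (Ide C X) = X" "Cod C (Ide C X) = X"
  using Ide_hom[OF assms] by (auto simp: hom_def)

lemmas arr_simps = Comp_Arr Comp_assoc_Arr Comp_Ide_Arr Ide_Arr Dom_Obj Cod_Obj

text \<open>The inverse is an explicit argument, so that it can be composed with and cancelled;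
  \<open>iso_arr\<close> hides it under a quantifier.\<close>

definition inverse_arrs :: "'a \<Rightarrow> 'a \<Rightarrow> bool"
  where "inverse_arrs u v \<longleftrightarrow> u \<in> Arr C \<and> v \<in> Arr C \<and> Dom C v = Cod C u \<and> Cod C v = Dom C u \<and>
    v \<cdot> u = Ide C (Dom C u) \<and> u \<cdot> v = Ide C (Cod C u)"

lemma inverse_arrs_sym: "inverse_arrs u v \<Longrightarrow> inverse_arrs v u"
  by (auto simp: inverse_arrs_def)

lemma inverse_arrsD:
  assumes "inverse_arrs u v"
  shows "u \<in> Arr C" "v \<in> Arr C" "Dom C v = Cod C u" "Cod C v = Dom C u"
    "v \<cdot> u = Ide C (Dom C u)" "u \<cdot> v = Ide C (Cod C u)"
  using assms by (auto simp: inverse_arrs_def)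

text \<open>Rewriting with \<open>arr_simps\<close> associates composites to the right, so u and v
  usually meet in front of a further factor f.\<close>

lemma inverse_arrs_cancel:
  assumes "inverse_arrs u v" "f \<in> Arr C"
  shows "Cod C f = Dom C u \<Longrightarrow> v \<cdot> (u \<cdot> f) = f" "Cod C f = Cod C u \<Longrightarrow> u \<cdot> (v \<cdot> f) = f"
  using assms by (auto simp: inverse_arrs_def Comp_assoc_Arr[symmetric] Comp_Ide_Arr)

lemma iso_arr_iff_inverse_arrs: "iso_arr C u \<longleftrightarrow> (\<exists>v. inverse_arrs u v)"
  by (auto simp: iso_arr_def inverse_arrs_def hom_def)

lemma iso_obj_iff_inverse_arrs:
  "iso_obj C X Y \<longleftrightarrow> (\<exists>u v. inverse_arrs u v \<and> Dom C u = X \<and> Cod C u = Y)"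
  by (auto simp: iso_obj_def iso_arr_iff_inverse_arrs hom_def inverse_arrs_def)

lemma inverse_arrs_Ide: "X \<in> Obj C \<Longrightarrow> inverse_arrs (Ide C X) (Ide C X)"
  by (simp add: inverse_arrs_def arr_simps)

lemma inverse_arrs_Comp:
  assumes "inverse_arrs u v" "inverse_arrs u' v'" "Cod C u = Dom C u'"
  shows "inverse_arrs (u' \<cdot> u) (v \<cdot> v')"
  unfolding inverse_arrs_def using assms inverse_arrsD[OF assms(1)] inverse_arrsD[OF assms(2)]
  by (simp add: arr_simps inverse_arrs_cancel)

lemma iso_obj_refl: "X \<in> Obj C \<Longrightarrow> iso_obj C X X"
  by (metis iso_obj_iff_inverse_arrs inverse_arrs_Ide Ide_Arr(2,3))

lemma iso_obj_sym: "iso_obj C X Y \<Longrightarrow> iso_obj C Y X"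
  by (metis iso_obj_iff_inverse_arrs inverse_arrs_sym inverse_arrsD(3,4))

lemma iso_obj_trans: "iso_obj C X Y \<Longrightarrow> iso_obj C Y Z \<Longrightarrow> iso_obj C X Z"
  unfolding iso_obj_iff_inverse_arrs by (metis inverse_arrs_Comp Comp_Arr(2,3) inverse_arrsD(1))

lemma rep_obj_class:
  assumes "X \<in> obj_classes C"
  shows "rep X \<in> X" "rep X \<in> Obj C" "obj_class C (rep X) = X"
proof -
  obtain Y where Y: "Y \<in> Obj C" "X = obj_class C Y"
    using assms by (auto simp: obj_classes_def)
  then have "Y \<in> X"
    by (simp add: obj_class_def iso_obj_refl)
  then show *: "rep X \<in> X"
    unfolding rep_def by (rule someI)
  then show "rep X \<in> Obj C"
    using Y by (simp add: obj_class_def)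
  show "obj_class C (rep X) = X"
    using * Y by (auto simp: obj_class_def intro: iso_obj_trans iso_obj_sym)
qed

section \<open>Monomorphisms and pushouts\<close>

lemma monicD:
  assumes "monic C m" "f \<in> Arr C" "g \<in> Arr C" "Cod C f = Dom C m" "Cod C g = Dom C m"
    "Dom C f = Dom C g" "m \<cdot> f = m \<cdot> g"
  shows "f = g"
  using assms by (auto simp: monic_def hom_def)

lemma monic_Comp_inverse:
  assumes m: "monic C m" and u: "inverse_arrs u v" "Cod C u = Dom C m"
  shows "monic C (m \<cdot> u)"
proof -
  note [simp] = arr_simps inverse_arrsD[OF u(1)] u(2)
  have [simp]: "m \<in> Arr C"
    using m by (simp add: monic_def)
  show ?thesis
    unfolding monic_def
  proof (intro conjI allI ballI impI)
    fix Z f g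
    assume "f \<in> hom C Z (Dom C (m \<cdot> u))" "g \<in> hom C Z (Dom C (m \<cdot> u))" and eq: "m \<cdot> u \<cdot> f = m \<cdot> u \<cdot> g"
    then have [simp]: "f \<in> Arr C" "g \<in> Arr C" "Dom C f = Z" "Dom C g = Z" "Cod C f = Dom C u" "Cod C g = Dom C u"
      by (auto dest: homD)
    have "u \<cdot> f = u \<cdot> g"
      by (rule monicD[OF m]) (use eq in simp_all)
    then have "v \<cdot> (u \<cdot> f) = v \<cdot> (u \<cdot> g)" by simp
    then show "f = g" by (simp add: inverse_arrs_cancel[OF u(1)])
  qed simp
qed

lemma is_pushoutD:
  assumes "is_pushout C f g p q"
  shows "f \<in> Arr C" "g \<in> Arr C" "p \<in> Arr C" "q \<in> Arr C"
    "Dom C g = Dom C f" "Dom C p = Cod C f" "Dom C q = Cod C g" "Cod C q = Cod C p" "p \<cdot> f = q \<cdot> g"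
  using assms by (auto simp: is_pushout_def)

lemma is_pushout_universal:
  assumes "is_pushout C f g p q" "p' \<in> hom C (Cod C f) T" "q' \<in> hom C (Cod C g) T" "p' \<cdot> f = q' \<cdot> g"
  shows "\<exists>!u. u \<in> hom C (Cod C p) T \<and> u \<cdot> p = p' \<and> u \<cdot> q = q'"
  using assms unfolding is_pushout_def by blast

lemma is_pushout_endo_Ide:
  assumes po: "is_pushout C f g p q" and u: "u \<in> hom C (Cod C p) (Cod C p)" "u \<cdot> p = p" "u \<cdot> q = q"
  shows "u = Ide C (Cod C p)"
proof -
  note [simp] = arr_simps is_pushoutD[OF po]
  have "\<exists>!u. u \<in> hom C (Cod C p) (Cod C p) \<and> u \<cdot> p = p \<and> u \<cdot> q = q"
    by (intro is_pushout_universal[OF po]) (simp_all add: hom_def)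
  moreover have "Ide C (Cod C p) \<in> hom C (Cod C p) (Cod C p) \<and> Ide C (Cod C p) \<cdot> p = p \<and> Ide C (Cod C p) \<cdot> q = q"
    by (simp add: hom_def)
  ultimately show ?thesis
    using u by blast
qed

lemma is_pushout_unique:
  assumes po: "is_pushout C f g p q" and po': "is_pushout C f g p' q'"
  shows "iso_obj C (Cod C p) (Cod C p')"
proof -
  have cocone: "p \<in> hom C (Cod C f) (Cod C p)" "q \<in> hom C (Cod C g) (Cod C p)" "p \<cdot> f = q \<cdot> g"
    if "is_pushout C f g p q" for p q
    using is_pushoutD[OF that] by (simp_all add: hom_def)
  obtain u where u: "u \<in> hom C (Cod C p) (Cod C p')" "u \<cdot> p = p'" "u \<cdot> q = q'"
    using is_pushout_universal[OF po cocone[OF po']] by blast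
  obtain v where v: "v \<in> hom C (Cod C p') (Cod C p)" "v \<cdot> p' = p" "v \<cdot> q' = q"
    using is_pushout_universal[OF po' cocone[OF po]] by blast
  note [simp] = arr_simps homD[OF u(1)] homD[OF v(1)] u(2,3) v(2,3)
    is_pushoutD(3,4,6-8)[OF po] is_pushoutD(3,4,6-8)[OF po']
  have "v \<cdot> u = Ide C (Cod C p)"
    by (intro is_pushout_endo_Ide[OF po]) (simp_all add: hom_def)
  moreover have "u \<cdot> v = Ide C (Cod C p')"
    by (intro is_pushout_endo_Ide[OF po']) (simp_all add: hom_def)
  ultimately have "inverse_arrs u v"
    by (simp add: inverse_arrs_def)
  then show ?thesis
    unfolding iso_obj_iff_inverse_arrs by (intro exI[of _ u] exI[of _ v]) simp
qed

text \<open>\<open>rewrite_class\<close> collects every pushout object; moving the cocone along u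
  reaches all objects isomorphic to a given one.\<close>

lemma is_pushout_Comp_inverse:
  assumes po: "is_pushout C f g p q" and u: "inverse_arrs u v" "Dom C u = Cod C p"
  shows "is_pushout C f g (u \<cdot> p) (u \<cdot> q)"
proof -
  note [simp] = arr_simps is_pushoutD[OF po] inverse_arrsD[OF u(1)] u(2)
  show ?thesis
    unfolding is_pushout_def
  proof (intro conjI allI ballI impI)
    fix T p' q' assume p'q': "p' \<in> hom C (Cod C f) T" "q' \<in> hom C (Cod C g) T" "p' \<cdot> f = q' \<cdot> g"
    obtain x where x: "x \<in> hom C (Cod C p) T" "x \<cdot> p = p'" "x \<cdot> q = q'"
      and unique: "\<And>y. y \<in> hom C (Cod C p) T \<Longrightarrow> y \<cdot> p = p' \<Longrightarrow> y \<cdot> q = q' \<Longrightarrow> y = x"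
      using is_pushout_universal[OF po p'q'] by blast
    note [simp] = homD[OF x(1)] x(2,3) inverse_arrs_cancel[OF u(1)]
    show "\<exists>!x. x \<in> hom C (Cod C (u \<cdot> p)) T \<and> x \<cdot> (u \<cdot> p) = p' \<and> x \<cdot> (u \<cdot> q) = q'"
    \<comment> \<open>The mediating arrow of the moved cocone undoes u and continues with the old
      one.\<close>
    proof (rule ex1I[of _ "x \<cdot> v"])
      fix y assume y: "y \<in> hom C (Cod C (u \<cdot> p)) T \<and> y \<cdot> (u \<cdot> p) = p' \<and> y \<cdot> (u \<cdot> q) = q'"
      then have [simp]: "y \<in> Arr C" "Dom C y = Cod C u" "Cod C y = T"
        by (auto dest: homD)
      have "y \<cdot> u = x"
        using y by (intro unique) (simp_all add: hom_def)
      then have "x \<cdot> v = (y \<cdot> u) \<cdot> v" by simp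
      also have "\<dots> = y" by simp
      finally show "y = x \<cdot> v" ..
    qed (simp add: hom_def)
  qed simp_all
qed

text \<open>The leg i is exchanged for an isomorphic i', and d and m are precomposed with inverses,
  while e and the pushout object stay. Cocones under the two spans correspond by p to
  \<open>p \<cdot> z\<close>, with the same mediating arrows.\<close>

lemma is_pushout_change_span:
  assumes po: "is_pushout C i d m e" and z: "inverse_arrs z z'" and u: "inverse_arrs u u'"
    and ty: "Dom C z = Cod C i" "Dom C u = Dom C i" "i' \<in> Arr C" "Dom C i' = Cod C u" "Cod C i' = Cod C z"
    and sq: "z \<cdot> i = i' \<cdot> u"
  shows "is_pushout C i' (d \<cdot> u') (m \<cdot> z') e"
proof -
  note [simp] = arr_simps is_pushoutD[OF po] inverse_arrsD[OF z] inverse_arrsD[OF u] ty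
    inverse_arrs_cancel[OF z] inverse_arrs_cancel[OF u]
  have "i' = i' \<cdot> (u \<cdot> u')" by simp
  also have "\<dots> = (z \<cdot> i) \<cdot> u'" unfolding sq by (simp del: inverse_arrsD)
  finally have i': "i' = z \<cdot> (i \<cdot> u')" by simp
  have sq': "z' \<cdot> i' = i \<cdot> u'" by (subst i') simp
  have sq'': "m \<cdot> (i \<cdot> u') = e \<cdot> (d \<cdot> u')"
    using is_pushoutD(9)[OF po] by (simp flip: Comp_assoc_Arr)
  show ?thesis
    unfolding is_pushout_def
  proof (intro conjI allI ballI impI)
    fix T p q assume p: "p \<in> hom C (Cod C i') T" and q: "q \<in> hom C (Cod C (d \<cdot> u')) T" and pq: "p \<cdot> i' = q \<cdot> (d \<cdot> u')"
    have [simp]: "p \<in> Arr C" "q \<in> Arr C" "Dom C p = Cod C z" "Cod C p = T" "Dom C q = Cod C d" "Cod C q = T"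
      using p q by (auto dest: homD)
    have "(p \<cdot> z) \<cdot> i = (p \<cdot> i') \<cdot> u" by (simp add: sq)
    also have "\<dots> = q \<cdot> d" unfolding pq by simp
    finally have "(p \<cdot> z) \<cdot> i = q \<cdot> d" .
    then have ex1: "\<exists>!x. x \<in> hom C (Cod C m) T \<and> x \<cdot> m = p \<cdot> z \<and> x \<cdot> e = q"
      by (intro is_pushout_universal[OF po]) (simp_all add: hom_def)
    have "x \<cdot> m = p \<cdot> z \<longleftrightarrow> x \<cdot> (m \<cdot> z') = p" if "x \<in> hom C (Cod C m) T" for x
    proof -
      note [simp] = homD[OF that]
      show ?thesis
      proof
        assume "x \<cdot> m = p \<cdot> z"
        then have "(x \<cdot> m) \<cdot> z' = (p \<cdot> z) \<cdot> z'" by simp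
        then show "x \<cdot> (m \<cdot> z') = p" by simp
      next
        assume "x \<cdot> (m \<cdot> z') = p"
        then have "(x \<cdot> (m \<cdot> z')) \<cdot> z = p \<cdot> z" by simp
        then show "x \<cdot> m = p \<cdot> z" by simp
      qed
    qed
    with ex1 show "\<exists>!x. x \<in> hom C (Cod C (m \<cdot> z')) T \<and> x \<cdot> (m \<cdot> z') = p \<and> x \<cdot> e = q"
      by (simp cong: conj_cong)
  qed (simp_all add: sq' sq'')
qed

text \<open>Supplies a pushout complement when the input leg is an identity, as in
  \<open>vertex_count\<close>: every monic is then a match.\<close>

lemma is_pushout_Ide:
  assumes "m \<in> Arr C"
  shows "is_pushout C (Ide C (Dom C m)) m m (Ide C (Cod C m))"
proof -
  note [simp] = arr_simps assms
  show ?thesis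
    unfolding is_pushout_def
  proof (intro conjI allI ballI impI)
    fix T p q
    assume p: "p \<in> hom C (Cod C (Ide C (Dom C m))) T" and q: "q \<in> hom C (Cod C m) T"
      and pq: "p \<cdot> Ide C (Dom C m) = q \<cdot> m"
    have "q \<cdot> m = p"
      using homD[OF p] pq by simp
    then show "\<exists>!u. u \<in> hom C (Cod C m) T \<and> u \<cdot> m = p \<and> u \<cdot> Ide C (Cod C m) = q"
      using q Comp_Ide_right by metis
  qed simp_all
qed

lemma monic_Ide: "X \<in> Obj C \<Longrightarrow> monic C (Ide C X)"
  by (auto simp: monic_def hom_def arr_simps)

section \<open>Independence of the chosen representative of a rule class\<close>

definition rule_iso_by :: "'a rule \<Rightarrow> 'a rule \<Rightarrow> 'a \<times> 'a \<times> 'a \<Rightarrow> 'a \<times> 'a \<times> 'a \<Rightarrow> bool"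
  where "rule_iso_by r r' = (\<lambda>(w, u, z) (w', u', z').
    inverse_arrs w w' \<and> inverse_arrs u u' \<and> inverse_arrs z z' \<and>
    Dom C w = Cod C (fst r) \<and> Cod C w = Cod C (fst r') \<and>
    Dom C u = Dom C (fst r) \<and> Cod C u = Dom C (fst r') \<and>
    Dom C z = Cod C (snd r) \<and> Cod C z = Cod C (snd r') \<and>
    w \<cdot> fst r = fst r' \<cdot> u \<and> z \<cdot> snd r = snd r' \<cdot> u)"

text \<open>The triple of inverses is carried along so that an isomorphism of rules is reversed by
  exchanging the two triples.\<close>

lemma rule_iso_iff_rule_iso_by: "rule_iso C r r' \<longleftrightarrow> (\<exists>t t'. rule_iso_by r r' t t')"
  unfolding rule_iso_def rule_iso_by_def iso_arr_iff_inverse_arrs hom_def split_paired_Ex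
  by (auto dest: inverse_arrsD(1))

lemma linear_ruleD:
  assumes "linear_rule C r"
  shows "fst r \<in> Arr C" "snd r \<in> Arr C" "Dom C (snd r) = Dom C (fst r)"
  using assms by (auto simp: linear_rule_def monic_def)

lemma inverse_square:
  assumes w: "inverse_arrs w w'" and u: "inverse_arrs u u'"
    and ty: "f \<in> Arr C" "g \<in> Arr C" "Dom C w = Cod C f" "Cod C w = Cod C g" "Dom C u = Dom C f" "Cod C u = Dom C g"
    and sq: "w \<cdot> f = g \<cdot> u"
  shows "w' \<cdot> g = f \<cdot> u'"
proof -
  note [simp] = arr_simps inverse_arrsD[OF w] inverse_arrsD[OF u] ty inverse_arrs_cancel[OF w] inverse_arrs_cancel[OF u]
  have "w' \<cdot> g = w' \<cdot> ((g \<cdot> u) \<cdot> u')" by simp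
  also have "\<dots> = f \<cdot> u'" unfolding sq[symmetric] by simp
  finally show ?thesis .
qed

lemma rule_iso_by_sym:
  assumes "linear_rule C r" "linear_rule C r'" "rule_iso_by r r' t t'"
  shows "rule_iso_by r' r t' t"
proof -
  obtain w u z w' u' z' where t: "t = (w, u, z)" "t' = (w', u', z')"
    by (cases t; cases t') auto
  have inv: "inverse_arrs w w'" "inverse_arrs u u'" "inverse_arrs z z'"
    using assms(3) by (auto simp: rule_iso_by_def t)
  have "w' \<cdot> fst r' = fst r \<cdot> u'" "z' \<cdot> snd r' = snd r \<cdot> u'"
    using assms(3) linear_ruleD[OF assms(1)] linear_ruleD[OF assms(2)]
    by (auto simp: rule_iso_by_def t intro!: inverse_square[OF inv(1,2)] inverse_square[OF inv(3,2)])
  then show ?thesis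
    using assms(3) inverse_arrsD(3,4)[OF inv(1)] inverse_arrsD(3,4)[OF inv(2)] inverse_arrsD(3,4)[OF inv(3)]
    by (simp add: rule_iso_by_def t inverse_arrs_sym)
qed

text \<open>The arrow \<open>d \<cdot> u'\<close> serves the input and the output square at once, so
  the step passes to r' with the same result object. Only an inclusion comes out; the reverse one is
  obtained from the inverse isomorphism.\<close>

lemma matches_rewrite_class_transport:
  assumes r: "linear_rule C r" and r': "linear_rule C r'" and iso: "rule_iso_by r r' (w, u, z) (w', u', z')"
    and m: "m \<in> matches C r X"
  shows "m \<cdot> z' \<in> matches C r' X" "rewrite_class C r m \<subseteq> rewrite_class C r' (m \<cdot> z')"
proof -
  from iso have w: "inverse_arrs w w'" and u: "inverse_arrs u u'" and z: "inverse_arrs z z'"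
    and ty: "Dom C w = Cod C (fst r)" "Cod C w = Cod C (fst r')" "Dom C u = Dom C (fst r)"
      "Cod C u = Dom C (fst r')" "Dom C z = Cod C (snd r)" "Cod C z = Cod C (snd r')"
    and sq: "w \<cdot> fst r = fst r' \<cdot> u" "z \<cdot> snd r = snd r' \<cdot> u"
    by (auto simp: rule_iso_by_def)
  note [simp] = arr_simps inverse_arrsD[OF w] inverse_arrsD[OF u] inverse_arrsD[OF z] ty
    linear_ruleD[OF r] linear_ruleD[OF r']
  have in_po: "is_pushout C (snd r') (d \<cdot> u') (m \<cdot> z') e" if "is_pushout C (snd r) d m e" for d m e
    using that by (rule is_pushout_change_span[OF _ z u]) (simp_all add: sq)
  have out_po: "is_pushout C (fst r') (d \<cdot> u') (m \<cdot> w') e" if "is_pushout C (fst r) d m e" for d m e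
    using that by (rule is_pushout_change_span[OF _ w u]) (simp_all add: sq)
  have m': "monic C m" and [simp]: "m \<in> Arr C" "Dom C m = Cod C (snd r)" "Cod C m = X"
    using m by (auto simp: matches_def hom_def)
  have "monic C (m \<cdot> z')"
    using m' by (rule monic_Comp_inverse[OF _ inverse_arrs_sym[OF z]]) simp
  moreover obtain d e where "is_pushout C (snd r) d m e"
    using m by (auto simp: matches_def)
  then have "\<exists>d e. is_pushout C (snd r') d (m \<cdot> z') e"
    using in_po by blast
  ultimately show "m \<cdot> z' \<in> matches C r' X"
    by (simp add: matches_def hom_def)
  show "rewrite_class C r m \<subseteq> rewrite_class C r' (m \<cdot> z')"
  proof
    fix Y assume "Y \<in> rewrite_class C r m"
    then obtain d e m' e' where po: "is_pushout C (snd r) d m e" "is_pushout C (fst r) d m' e'" and Y: "Y = Cod C m'"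
      by (auto simp: rewrite_class_def)
    have "Cod C (m' \<cdot> w') = Y"
      using is_pushoutD[OF po(2)] Y by simp
    then show "Y \<in> rewrite_class C r' (m \<cdot> z')"
      using in_po[OF po(1)] out_po[OF po(2)] unfolding rewrite_class_def by blast
  qed
qed

text \<open>Composition with z' and with z are mutually inverse on matches, which also turns the two
  inclusions of results into an equality.\<close>

lemma matches_rule_iso:
  assumes r: "linear_rule C r" and r': "linear_rule C r'" and iso: "rule_iso C r r'"
  obtains b where "bij_betw b (matches C r X) (matches C r' X)"
    "\<And>m. m \<in> matches C r X \<Longrightarrow> rewrite_class C r' (b m) = rewrite_class C r m"
proof -
  obtain w u z w' u' z' where i: "rule_iso_by r r' (w, u, z) (w', u', z')"
    using iso by (auto simp: rule_iso_iff_rule_iso_by)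
  note i' = rule_iso_by_sym[OF r r' i]
  note to = matches_rewrite_class_transport[OF r r' i] and from' = matches_rewrite_class_transport[OF r' r i']
  have z: "inverse_arrs z z'" "Dom C z = Cod C (snd r)" "Cod C z = Cod C (snd r')"
    using i by (auto simp: rule_iso_by_def)
  note [simp] = arr_simps inverse_arrsD[OF z(1)] z(2,3)
  have c: "m \<cdot> z' \<cdot> z = m" if "m \<in> matches C r X" for m
    using that by (auto simp: matches_def hom_def)
  have c': "m \<cdot> z \<cdot> z' = m" if "m \<in> matches C r' X" for m
    using that by (auto simp: matches_def hom_def)
  show ?thesis
  proof (rule that[of "\<lambda>m. m \<cdot> z'"])
    show "bij_betw (\<lambda>m. m \<cdot> z') (matches C r X) (matches C r' X)"
      by (rule bij_betw_byWitness[where f' = "\<lambda>m. m \<cdot> z"]) (auto simp: c c' to(1) from'(1))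
    show "rewrite_class C r' (m \<cdot> z') = rewrite_class C r m" if "m \<in> matches C r X" for m
      using to(2)[OF that] from'(2)[OF to(1)[OF that]] c[OF that] by auto
  qed
qed

section \<open>Rules and observables on basis states\<close>

definition rule_step :: "'a rule \<Rightarrow> 'o \<Rightarrow> 'o state"
  where "rule_step r X = (\<Sum>m \<in> matches C r X. Poly_Mapping.single (rewrite_class C r m) 1)"

text \<open>\<open>rho\<close> applies a representative selected from the rule class; this lets the
  given rule act in its place.\<close>

lemma rule_step_rule_iso:
  assumes "linear_rule C r" "linear_rule C r'" "rule_iso C r r'"
  shows "rule_step r' X = rule_step r X"
proof -
  obtain b where b: "bij_betw b (matches C r X) (matches C r' X)"
    "\<And>m. m \<in> matches C r X \<Longrightarrow> rewrite_class C r' (b m) = rewrite_class C r m"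
    using matches_rule_iso[OF assms] by blast
  show ?thesis
    unfolding rule_step_def by (subst sum.reindex_bij_betw[OF b(1), symmetric]) (auto simp: b(2))
qed

lemma rule_iso_refl:
  assumes "linear_rule C r"
  shows "rule_iso C r r"
proof -
  note [simp] = arr_simps linear_ruleD[OF assms]
  have "rule_iso_by r r (Ide C (Cod C (fst r)), Ide C (Dom C (fst r)), Ide C (Cod C (snd r)))
      (Ide C (Cod C (fst r)), Ide C (Dom C (fst r)), Ide C (Cod C (snd r)))"
    by (simp add: rule_iso_by_def inverse_arrs_Ide)
  then show ?thesis
    unfolding rule_iso_iff_rule_iso_by by blast
qed

text \<open>\<open>obs\<close> doubles the input leg, so z acts on both sides and the output
  component w is dropped.\<close>

lemma rule_iso_input:
  assumes "linear_rule C r" "linear_rule C r'" "rule_iso C r r'"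
  shows "rule_iso C (snd r, snd r) (snd r', snd r')"
proof -
  obtain w u z w' u' z' where "rule_iso_by r r' (w, u, z) (w', u', z')"
    using assms(3) by (auto simp: rule_iso_iff_rule_iso_by)
  then have "rule_iso_by (snd r, snd r) (snd r', snd r') (z, u, z) (z', u', z')"
    by (auto simp: rule_iso_by_def linear_ruleD[OF assms(1)] linear_ruleD[OF assms(2)])
  then show ?thesis
    unfolding rule_iso_iff_rule_iso_by by blast
qed

lemma linear_rule_input: "linear_rule C r \<Longrightarrow> linear_rule C (snd r, snd r)"
  by (simp add: linear_rule_def)

lemma rep_rule_class:
  assumes "linear_rule C r"
  shows "linear_rule C (rep (rule_class C r))" "rule_iso C r (rep (rule_class C r))"
proof -
  have "r \<in> rule_class C r"
    using assms by (simp add: rule_class_def rule_iso_refl)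
  then have "rep (rule_class C r) \<in> rule_class C r"
    unfolding rep_def by (rule someI)
  then show "linear_rule C (rep (rule_class C r))" "rule_iso C r (rep (rule_class C r))"
    by (auto simp: rule_class_def)
qed

lemma rho_delta:
  assumes "linear_rule C r"
  shows "rho C (delta C r) = lin_ext (obj_classes C) (\<lambda>X. rule_step r (rep X))"
proof
  fix v
  have "rule_class C r \<in> rule_classes C"
    using assms by (simp add: rule_classes_def)
  then have "rho C (delta C r) v = lin_ext (obj_classes C) (\<lambda>X. rule_step (rep (rule_class C r)) (rep X)) v"
    by (simp add: rho_def delta_def lin_ext_def rule_step_def)
  then show "rho C (delta C r) v = lin_ext (obj_classes C) (\<lambda>X. rule_step r (rep X)) v"
    by (simp add: rule_step_rule_iso[OF assms rep_rule_class[OF assms]])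
qed

text \<open>With equal legs both rewriting squares are pushouts of one span. Uniqueness makes every
  result isomorphic to X, and moving the cocone reaches every such object. Hence observables are
  diagonal.\<close>

lemma rewrite_class_input:
  assumes m: "m \<in> matches C (i, i) X"
  shows "rewrite_class C (i, i) m = obj_class C X"
proof (intro equalityI subsetI)
  have X: "Cod C m = X"
    using m by (auto simp: matches_def hom_def)
  fix Y
  {
    assume "Y \<in> rewrite_class C (i, i) m"
    then obtain d e m' e' where po: "is_pushout C i d m e" "is_pushout C i d m' e'" and Y: "Y = Cod C m'"
      by (auto simp: rewrite_class_def)
    then show "Y \<in> obj_class C X"
      using is_pushout_unique[OF po] X by (auto simp: obj_class_def Cod_Obj is_pushoutD)
  }
  assume "Y \<in> obj_class C X"
  then obtain u v where u: "inverse_arrs u v" "Dom C u = X" "Cod C u = Y"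
    by (auto simp: obj_class_def iso_obj_iff_inverse_arrs)
  obtain d e where po: "is_pushout C i d m e"
    using m by (auto simp: matches_def)
  then have "is_pushout C i d (u \<cdot> m) (u \<cdot> e)"
    using u X by (intro is_pushout_Comp_inverse[where v = v]) simp_all
  moreover have "Cod C (u \<cdot> m) = Y"
    using u(2,3) X is_pushoutD[OF po] inverse_arrsD(1)[OF u(1)] by (simp add: Comp_Arr)
  ultimately show "Y \<in> rewrite_class C (i, i) m"
    using po unfolding rewrite_class_def by (auto 0 4)
qed

lemma rule_step_input:
  assumes "X \<in> obj_classes C"
  shows "rule_step (snd r, snd r) (rep X) = real (card (matches C r (rep X))) *\<^sub>R Poly_Mapping.single X 1"
proof -
  have "matches C (snd r, snd r) (rep X) = matches C r (rep X)"
    by (simp add: matches_def)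
  moreover have "rewrite_class C (snd r, snd r) m = X" if "m \<in> matches C (snd r, snd r) (rep X)" for m
    using rewrite_class_input[OF that] rep_obj_class[OF assms] by simp
  ultimately have "rule_step (snd r, snd r) (rep X) = (\<Sum>m \<in> matches C r (rep X). Poly_Mapping.single X 1)"
    by (simp add: rule_step_def)
  then show ?thesis
    by (simp add: scaleR_conv_of_real sum_constant_scaleR)
qed

lemma lin_ext_cong: "(\<And>X. X \<in> A \<Longrightarrow> T X = T' X) \<Longrightarrow> lin_ext A T v = lin_ext A T' v"
  by (simp add: lin_ext_def)

text \<open>Admissibility of a match involves the input leg only, so the eigenvalue can be given as
  the number of matches of r itself.\<close>

lemma obs_delta:
  assumes r: "linear_rule C r"
  shows "obs C (delta C r) = lin_ext (obj_classes C) (\<lambda>X. real (card (matches C r (rep X))) *\<^sub>R Poly_Mapping.single X 1)"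
proof
  fix v
  let ?r = "rep (rule_class C r)"
  have "obs C (delta C r) = rho C (delta C (snd ?r, snd ?r))"
    by (simp add: obs_def delta_def)
  also have "\<dots> = lin_ext (obj_classes C) (\<lambda>X. rule_step (snd r, snd r) (rep X))"
    using rule_step_rule_iso[OF linear_rule_input[OF r] linear_rule_input[OF rep_rule_class(1)[OF r]]
        rule_iso_input[OF r rep_rule_class[OF r]]]
    by (simp add: rho_delta[OF linear_rule_input[OF rep_rule_class(1)[OF r]]])
  finally show "obs C (delta C r) v = lin_ext (obj_classes C) (\<lambda>X. real (card (matches C r (rep X))) *\<^sub>R Poly_Mapping.single X 1) v"
    by (simp add: lin_ext_cong[OF rule_step_input])
qed

lemma bra_rho_eq_bra_obs:
  assumes r: "linear_rule C r"
  shows "bra (rho C (delta C r) v) = bra (obs C (delta C r) v)"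
  by (simp add: rho_delta[OF r] obs_delta[OF r] lin_ext_def rule_step_def
      linear_sum[OF linear_bra] linear_scale[OF linear_bra])

lemma linear_rho_delta: "linear_rule C r \<Longrightarrow> linear (rho C (delta C r))"
  by (simp add: rho_delta linear_lin_ext)

lemma linear_obs_delta: "linear_rule C r \<Longrightarrow> linear (obs C (delta C r))"
  by (simp add: obs_delta linear_lin_ext)

lemma obs_delta_states: "linear_rule C r \<Longrightarrow> obs C (delta C r) v \<in> states C"
  by (auto simp: states_def in_keys_iff obs_delta lin_ext_diagonal_lookup split: if_splits)

lemma obs_delta_commute:
  assumes "linear_rule C r" "linear_rule C s"
  shows "obs C (delta C r) (obs C (delta C s) v) = obs C (delta C s) (obs C (delta C r) v)"
  by (rule poly_mapping_eqI) (simp add: assms obs_delta lin_ext_diagonal_lookup)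

text \<open>The common entry point for both systems. For the given system \<open>c j\<close> is rate
  times prefactor, for the discrete one it is the rate alone.\<close>

lemma conversion_symbol_hamiltonian:
  fixes e :: "'i \<Rightarrow> 'j \<Rightarrow> real"
  assumes Ob: "connected_observables C I Ob"
    and r: "\<And>j. j \<in> J \<Longrightarrow> linear_rule C (r j)" and h: "\<And>j. j \<in> J \<Longrightarrow> h j = delta C (r j)"
    and ad: "\<And>i j v. \<lbrakk>i \<in> I; j \<in> J; v \<in> states C\<rbrakk> \<Longrightarrow> ad (Ob i) (rho C (h j)) v = e i j *\<^sub>R rho C (h j) v"
    and k: "\<And>j. j \<in> J \<Longrightarrow> Poly_Mapping.keys (k j) \<subseteq> I"
    and jumps: "\<And>j v. \<lbrakk>j \<in> J; v \<in> states C\<rbrakk>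
      \<Longrightarrow> \<kappa> j * bra (rho C (h j) v) = c j * bra_poly I Ob (jump_poly I (k j)) v"
  shows "conversion_symbol C I Ob (hamiltonian C J \<kappa> h) (evolution_symbol I J c e k)"
proof -
  have "\<forall>i \<in> I. \<exists>s. linear_rule C s \<and> Ob i = obs C (delta C s)"
    using Ob unfolding connected_observables_def connected_observable_def by blast
  then obtain s where s: "\<And>i. i \<in> I \<Longrightarrow> linear_rule C (s i)" and Ob_s: "\<And>i. i \<in> I \<Longrightarrow> Ob i = obs C (delta C (s i))"
    by metis
  show ?thesis
  proof (rule conversion_symbol_evolution_symbol)
    show "finite I"
      using Ob by (simp add: connected_observables_def)
    show "ad (Ob i) (obs C (h j)) v = 0" if "i \<in> I" "j \<in> J" for i j v
      using that by (simp add: Ob_s h ad_def obs_delta_commute r s)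
    show "hamiltonian C J \<kappa> h = (\<lambda>v. \<Sum>j \<in> J. \<kappa> j *\<^sub>R (rho C (h j) v - obs C (h j) v))"
      by (rule hamiltonian_def)
    show "ad (Ob i) (rho C (h j)) v = e i j *\<^sub>R rho C (h j) v" if "i \<in> I" "j \<in> J" "v \<in> states C" for i j v
      using that by (rule ad)
    show "\<kappa> j * bra (rho C (h j) v) = c j * bra_poly I Ob (jump_poly I (k j)) v"
      if "j \<in> J" "v \<in> states C" for j v
      using that by (rule jumps)
  qed (use k in \<open>simp_all add: Ob_s h r s linear_rho_delta linear_obs_delta obs_delta_states bra_rho_eq_bra_obs\<close>)
qed

end

section \<open>Falling factorials and counting of embeddings\<close>

text \<open>The argument is real and the differences are not truncated; for a natural number x < n
  one factor is 0, the right count when no embedding exists.\<close>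

definition falling :: "real \<Rightarrow> nat \<Rightarrow> real"
  where "falling x n = (\<Prod>t<n. x - real t)"

text \<open>Unsigned Stirling numbers are the coefficients of the rising factorial, taken here at
  -x. The sign in \<open>s1\<close> splits into \<open>(- 1) ^ n\<close> for its n factors and
  \<open>(- 1) ^ m\<close> for the power of x.\<close>

lemma sum_s1_powers: "(\<Sum>m\<le>n. s1 n m * x ^ m) = falling x n"
proof -
  have "s1 n m * x ^ m = (- 1) ^ n * (real (stirling n m) * (- x) ^ m)" if "m \<le> n" for m
  proof -
    have "(- 1 :: real) ^ n = (- 1) ^ (n - m) * (- 1) ^ m"
      using that by (simp flip: power_add)
    moreover have "(- x) ^ m = (- 1) ^ m * x ^ m"
      by (metis mult_minus1 power_mult_distrib)
    moreover have "(- 1 :: real) ^ m * (- 1) ^ m = 1"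
      by (simp flip: power_mult_distrib)
    ultimately show ?thesis
      by (simp add: s1_def)
  qed
  then have "(\<Sum>m\<le>n. s1 n m * x ^ m) = (- 1) ^ n * pochhammer (- x) n"
    by (simp add: sum_distrib_left flip: stirling_pochhammer)
  also have "\<dots> = (\<Prod>t<n. - 1 * (- x + real t))"
    by (simp only: prod.distrib pochhammer_prod) (simp add: lessThan_atLeast0)
  finally show ?thesis
    by (simp add: falling_def)
qed

text \<open>Expanding a product of one-variable sums chooses an exponent for each i in I; such
  choices are the multi-indices below k, which vanish outside I because k does.\<close>

lemma sum_s1_multi_powers:
  fixes k :: "'i \<Rightarrow>\<^sub>0 nat"
  assumes I: "finite I" and k: "Poly_Mapping.keys k \<subseteq> I"
  shows "(\<Sum>n | \<forall>i. Poly_Mapping.lookup n i \<le> Poly_Mapping.lookup k i.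
      s1_multi I k n * (\<Prod>i \<in> I. x i ^ Poly_Mapping.lookup n i)) =
    (\<Prod>i \<in> I. falling (x i) (Poly_Mapping.lookup k i))"
proof -
  let ?N = "{n. \<forall>i. Poly_Mapping.lookup n i \<le> Poly_Mapping.lookup k i}"
  let ?P = "\<Pi>\<^sub>E i \<in> I. {..Poly_Mapping.lookup k i}"
  let ?g = "\<lambda>f. Abs_poly_mapping (\<lambda>i. if i \<in> I then f i else 0)"
  have k0: "Poly_Mapping.lookup k i = 0" if "i \<notin> I" for i
    using that k by (auto simp: in_keys_iff)
  have g: "Poly_Mapping.lookup (?g f) = (\<lambda>i. if i \<in> I then f i else 0)" for f :: "'i \<Rightarrow> nat"
    by (intro lookup_Abs_poly_mapping finite_subset[OF _ I]) auto
  have bij: "bij_betw (\<lambda>n. restrict (Poly_Mapping.lookup n) I) ?N ?P"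
  proof (rule bij_betw_byWitness[where f' = ?g])
    show "\<forall>n \<in> ?N. ?g (restrict (Poly_Mapping.lookup n) I) = n"
    proof (intro ballI poly_mapping_eqI)
      fix n i assume "n \<in> ?N"
      then have "Poly_Mapping.lookup n i \<le> Poly_Mapping.lookup k i" by simp
      then show "Poly_Mapping.lookup (?g (restrict (Poly_Mapping.lookup n) I)) i = Poly_Mapping.lookup n i"
        by (cases "i \<in> I") (auto simp: g k0)
    qed
  qed (auto simp: g PiE_def extensional_def)
  have "(\<Prod>i \<in> I. falling (x i) (Poly_Mapping.lookup k i)) =
      (\<Prod>i \<in> I. \<Sum>m\<le>Poly_Mapping.lookup k i. s1 (Poly_Mapping.lookup k i) m * x i ^ m)"
    by (simp add: sum_s1_powers)
  also have "\<dots> = (\<Sum>f \<in> ?P. \<Prod>i \<in> I. s1 (Poly_Mapping.lookup k i) (f i) * x i ^ f i)"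
    using I by (intro prod_sum_PiE) auto
  also have "\<dots> = (\<Sum>n \<in> ?N. \<Prod>i \<in> I. s1 (Poly_Mapping.lookup k i) (restrict (Poly_Mapping.lookup n) I i) *
      x i ^ restrict (Poly_Mapping.lookup n) I i)"
    by (rule sum.reindex_bij_betw[OF bij, symmetric])
  finally show ?thesis
    by (simp add: s1_multi_def prod.distrib)
qed

text \<open>The case m = 0 is separate because the identity retains coefficients outside A, which
  any positive power annihilates.\<close>

lemma lookup_funpow_diagonal:
  fixes Ob :: "'o operator"
  assumes "\<And>v X. Poly_Mapping.lookup (Ob v) X = (if X \<in> A then a X * Poly_Mapping.lookup v X else 0)"
  shows "Poly_Mapping.lookup ((Ob ^^ m) v) X =
    (if m = 0 then Poly_Mapping.lookup v X else if X \<in> A then a X ^ m * Poly_Mapping.lookup v X else 0)"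
  by (induction m) (auto simp: assms)

text \<open>\<open>monomial_op\<close> is a fold over a set, unfolded by way of commuting factors;
  diagonal operators commute coefficientwise. A state supported in A does not feel the difference
  between power 0 and positive powers outside A.\<close>

lemma lookup_monomial_op_diagonal:
  fixes Ob :: "'i \<Rightarrow> 'o operator"
  assumes I: "finite I"
    and Ob: "\<And>i v X. i \<in> I \<Longrightarrow>
      Poly_Mapping.lookup (Ob i v) X = (if X \<in> A then a i X * Poly_Mapping.lookup v X else 0)"
    and v: "Poly_Mapping.keys v \<subseteq> A"
  shows "Poly_Mapping.lookup (monomial_op I Ob n v) X =
    (\<Prod>i \<in> I. a i X ^ Poly_Mapping.lookup n i) * Poly_Mapping.lookup v X"
proof -
  let ?f = "\<lambda>i B. (Ob i ^^ Poly_Mapping.lookup n i) \<circ> B"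
  note pow = lookup_funpow_diagonal[OF Ob]
  interpret comp_fun_commute_on I ?f
  proof
    fix i j assume "i \<in> I" "j \<in> I"
    then have "(Ob j ^^ Poly_Mapping.lookup n j) ((Ob i ^^ Poly_Mapping.lookup n i) w) =
        (Ob i ^^ Poly_Mapping.lookup n i) ((Ob j ^^ Poly_Mapping.lookup n j) w)" for w
      by (intro poly_mapping_eqI) (simp add: pow)
    then show "?f j \<circ> ?f i = ?f i \<circ> ?f j"
      by (auto simp: fun_eq_iff)
  qed
  have "Poly_Mapping.lookup (Finite_Set.fold ?f id F v) X =
      (\<Prod>i \<in> F. a i X ^ Poly_Mapping.lookup n i) * Poly_Mapping.lookup v X" if "F \<subseteq> I" for F
    using finite_subset[OF that I] that
  proof (induction F rule: finite_induct)
    case (insert i F)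
    have "Poly_Mapping.lookup v X = 0" if "X \<notin> A"
      using that v by (auto simp: in_keys_iff)
    moreover have "Finite_Set.fold ?f id (insert i F) = ?f i (Finite_Set.fold ?f id F)"
      using insert by (intro fold_insert) auto
    ultimately show ?case
      using insert by (simp add: pow del: o_apply) (auto simp: pow)
  qed simp
  then show ?thesis
    by (simp add: monomial_op_def)
qed

text \<open>The observables share an eigenbasis, so a polynomial in them acts on a basis vector as
  its value at the joint eigenvalue, here a product of falling factorials.\<close>

lemma bra_poly_jump_poly_diagonal:
  fixes Ob :: "'i \<Rightarrow> 'o operator"
  assumes I: "finite I"
    and Ob: "\<And>i v X. i \<in> I \<Longrightarrow>
      Poly_Mapping.lookup (Ob i v) X = (if X \<in> A then a i X * Poly_Mapping.lookup v X else 0)"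
    and v: "Poly_Mapping.keys v \<subseteq> A" and k: "Poly_Mapping.keys k \<subseteq> I"
  shows "bra_poly I Ob (jump_poly I k) v =
    (\<Sum>X \<in> Poly_Mapping.keys v. Poly_Mapping.lookup v X * (\<Prod>i \<in> I. falling (a i X) (Poly_Mapping.lookup k i)))"
proof -
  have "bra (monomial_op I Ob n v) =
      (\<Sum>X \<in> Poly_Mapping.keys v. Poly_Mapping.lookup v X * (\<Prod>i \<in> I. a i X ^ Poly_Mapping.lookup n i))" for n
    unfolding bra_def
    by (intro sum.mono_neutral_cong_left)
      (auto simp: in_keys_iff lookup_monomial_op_diagonal[where a = a, OF I Ob v])
  then have "bra_poly I Ob (jump_poly I k) v =
      (\<Sum>n | \<forall>i. Poly_Mapping.lookup n i \<le> Poly_Mapping.lookup k i. \<Sum>X \<in> Poly_Mapping.keys v.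
        Poly_Mapping.lookup v X * (s1_multi I k n * (\<Prod>i \<in> I. a i X ^ Poly_Mapping.lookup n i)))"
    by (simp add: bra_poly_jump_poly sum_distrib_left mult_ac)
  also have "\<dots> = (\<Sum>X \<in> Poly_Mapping.keys v. Poly_Mapping.lookup v X *
      (\<Prod>i \<in> I. falling (a i X) (Poly_Mapping.lookup k i)))"
    by (subst sum.swap) (simp add: sum_s1_multi_powers[OF I k] flip: sum_distrib_left)
  finally show ?thesis .
qed

section \<open>Counting colour-preserving embeddings\<close>

definition colour_maps :: "'c dgraph \<Rightarrow> 'c dgraph \<Rightarrow> ('c \<times> nat \<Rightarrow> 'c \<times> nat) set"
  where "colour_maps V W = {f \<in> V \<rightarrow>\<^sub>E W. \<forall>x \<in> V. fst (f x) = fst x}"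

text \<open>The functions are extensional, like the middle component of an arrow in
  \<open>discrete_cat\<close>, so \<open>card\<close> counts maps on V and not their
  extensions.\<close>

definition embeddings :: "'c dgraph \<Rightarrow> 'c dgraph \<Rightarrow> ('c \<times> nat \<Rightarrow> 'c \<times> nat) set"
  where "embeddings V W = {f \<in> colour_maps V W. inj_on f V}"

definition colour_count :: "'c dgraph \<Rightarrow> 'c \<Rightarrow> nat"
  where "colour_count V c = card {x \<in> V. fst x = c}"

lemma finite_embeddings: "finite V \<Longrightarrow> finite W \<Longrightarrow> finite (embeddings V W)"
  by (rule finite_subset[of _ "V \<rightarrow>\<^sub>E W"]) (auto simp: embeddings_def colour_maps_def intro: finite_PiE)

lemma colour_count_insert:
  assumes "finite V" "x \<notin> V"
  shows "colour_count (insert x V) c = colour_count V c + (if c = fst x then 1 else 0)"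
proof -
  have "{y \<in> insert x V. fst y = c} = (if c = fst x then insert x {y \<in> V. fst y = c} else {y \<in> V. fst y = c})"
    by auto
  then show ?thesis
    using assms by (simp add: colour_count_def)
qed

lemma embedding_fibre:
  assumes "f \<in> embeddings V W" and W: "finite W"
  shows "f ` {x \<in> V. fst x = c} \<subseteq> {y \<in> W. fst y = c}"
    "card (f ` {x \<in> V. fst x = c}) = colour_count V c" "colour_count V c \<le> colour_count W c"
proof -
  have inj: "inj_on f {x \<in> V. fst x = c}"
    using assms(1) by (auto simp: embeddings_def intro: inj_on_subset)
  show sub: "f ` {x \<in> V. fst x = c} \<subseteq> {y \<in> W. fst y = c}"
    using assms by (auto simp: embeddings_def colour_maps_def)
  show card: "card (f ` {x \<in> V. fst x = c}) = colour_count V c"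
    using inj by (simp add: colour_count_def card_image)
  show "colour_count V c \<le> colour_count W c"
    using card_mono[OF _ sub] W card by (simp add: colour_count_def)
qed

lemma card_embeddings_insert:
  assumes V: "finite V" "x \<notin> V" and W: "finite W"
  shows "real (card (embeddings (insert x V) W)) =
    real (card (embeddings V W)) * (real (colour_count W (fst x)) - real (colour_count V (fst x)))"
proof -
  let ?B = "\<lambda>f. {y \<in> W. fst y = fst x} - f ` V"
  have "bij_betw (\<lambda>(f, y). f(x := y)) (SIGMA f:embeddings V W. ?B f) (embeddings (insert x V) W)"
  proof (rule bij_betw_byWitness[where f' = "\<lambda>f. (restrict f V, f x)"])
    show "\<forall>a \<in> SIGMA f:embeddings V W. ?B f.
        (\<lambda>f. (restrict f V, f x)) ((\<lambda>(f, y). f(x := y)) a) = a"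
      using V by (auto simp: embeddings_def colour_maps_def PiE_def extensional_def restrict_def fun_eq_iff)
    show "\<forall>f \<in> embeddings (insert x V) W. (\<lambda>(f, y). f(x := y)) ((\<lambda>f. (restrict f V, f x)) f) = f"
      using V by (auto simp: embeddings_def colour_maps_def PiE_def extensional_def restrict_def fun_eq_iff)
    show "(\<lambda>(f, y). f(x := y)) ` (SIGMA f:embeddings V W. ?B f) \<subseteq> embeddings (insert x V) W"
    proof clarify
      fix f c m assume f: "f \<in> embeddings V W" and y: "(c, m) \<in> W" "(c, m) \<notin> f ` V" "fst (c, m) = fst x"
      let ?f = "f(x := (c, m))"
      have "?f \<in> insert x V \<rightarrow>\<^sub>E W" "\<forall>z \<in> insert x V. fst (?f z) = fst z"
        using f y V by (auto simp: embeddings_def colour_maps_def PiE_def extensional_def)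
      moreover have "inj_on ?f (insert x V)"
        using f y V by (auto simp: embeddings_def inj_on_def image_iff)
      ultimately show "?f \<in> embeddings (insert x V) W"
        unfolding embeddings_def colour_maps_def by blast
    qed
    show "(\<lambda>f. (restrict f V, f x)) ` embeddings (insert x V) W \<subseteq> (SIGMA f:embeddings V W. ?B f)"
    proof (rule image_subsetI)
      fix f assume f: "f \<in> embeddings (insert x V) W"
      then have "restrict f V \<in> embeddings V W"
        by (auto simp: embeddings_def colour_maps_def inj_on_restrict_eq intro: inj_on_subset)
      moreover have "f x \<in> W" "fst (f x) = fst x" "f x \<notin> f ` V"
        using f V by (auto simp: embeddings_def colour_maps_def)
      ultimately show "(restrict f V, f x) \<in> (SIGMA f:embeddings V W. ?B f)"
        by simp
    qed
  qed
  then have "card (embeddings (insert x V) W) = card (SIGMA f:embeddings V W. ?B f)"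
    by (rule bij_betw_same_card[symmetric])
  also have "\<dots> = (\<Sum>f \<in> embeddings V W. card (?B f))"
    using V W by (intro card_SigmaI) (auto simp: finite_embeddings)
  finally have "real (card (embeddings (insert x V) W)) = (\<Sum>f \<in> embeddings V W. real (card (?B f)))"
    by simp
  also have "\<dots> = (\<Sum>f \<in> embeddings V W. real (colour_count W (fst x)) - real (colour_count V (fst x)))"
  proof (rule sum.cong[OF refl])
    fix f assume f: "f \<in> embeddings V W"
    note fibre = embedding_fibre[OF f W, of "fst x"]
    \<comment> \<open>Colours are preserved, so only vertices of V of the colour of x can occupy
      vertices of that colour.\<close>
    have "?B f = {y \<in> W. fst y = fst x} - f ` {y \<in> V. fst y = fst x}"
      using f by (auto simp: embeddings_def colour_maps_def)
    then have "card (?B f) = colour_count W (fst x) - colour_count V (fst x)"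
      using fibre V W by (simp add: card_Diff_subset colour_count_def)
    then show "real (card (?B f)) = real (colour_count W (fst x)) - real (colour_count V (fst x))"
      using fibre(3) by simp
  qed
  finally show ?thesis by simp
qed

lemma card_embeddings:
  assumes Col: "finite Col" and V: "finite V" "V \<subseteq> Col \<times> UNIV" and W: "finite W"
  shows "real (card (embeddings V W)) =
    (\<Prod>c \<in> Col. falling (real (colour_count W c)) (colour_count V c))"
  using V
proof (induction V rule: finite_induct)
  case empty
  have "embeddings {} W = {\<lambda>x. undefined}"
    by (auto simp: embeddings_def colour_maps_def)
  then show ?case
    by (simp add: colour_count_def falling_def)
next
  case (insert x V)
  have x: "fst x \<in> Col"
    using insert.prems by auto
  \<comment> \<open>Adding x raises one colour count by one and so appends one factor to one falling
    factorial.\<close>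
  have "(\<Prod>c \<in> Col. falling (real (colour_count W c)) (colour_count (insert x V) c)) =
      (\<Prod>c \<in> Col. falling (real (colour_count W c)) (colour_count V c) *
        (if c = fst x then real (colour_count W c) - real (colour_count V c) else 1))"
    using insert.hyps by (intro prod.cong) (auto simp: colour_count_insert falling_def)
  also have "\<dots> = (\<Prod>c \<in> Col. falling (real (colour_count W c)) (colour_count V c)) *
      (real (colour_count W (fst x)) - real (colour_count V (fst x)))"
    using Col x by (simp add: prod.distrib)
  finally show ?case
    using insert by (simp add: card_embeddings_insert W)
qed

section \<open>Pushouts of discrete graphs\<close>

lemma discrete_cat_simps [simp]:
  "V \<in> Obj (discrete_cat Col) \<longleftrightarrow> finite V \<and> V \<subseteq> Col \<times> UNIV"
  "(V, f, W) \<in> Arr (discrete_cat Col) \<longleftrightarrow>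
    V \<in> Obj (discrete_cat Col) \<and> W \<in> Obj (discrete_cat Col) \<and> f \<in> colour_maps V W"
  "Dom (discrete_cat Col) (V, f, W) = V"
  "Cod (discrete_cat Col) (V, f, W) = W"
  "Ide (discrete_cat Col) V = (V, restrict id V, V)"
  "(V', g, W) \<cdot>\<^bsub>discrete_cat Col\<^esub> (V, f, W') = (V, compose V g f, W)"
  by (auto simp: discrete_cat_def colour_maps_def)

lemma discrete_homE:
  assumes "a \<in> hom (discrete_cat Col) V W"
  obtains f where "a = (V, f, W)" "f \<in> colour_maps V W" "V \<in> Obj (discrete_cat Col)" "W \<in> Obj (discrete_cat Col)"
  using assms by (cases a) (auto simp: hom_def)

lemma discrete_homI:
  "f \<in> colour_maps V W \<Longrightarrow> V \<in> Obj (discrete_cat Col) \<Longrightarrow> W \<in> Obj (discrete_cat Col) \<Longrightarrow>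
    (V, f, W) \<in> hom (discrete_cat Col) V W"
  by (auto simp: hom_def)

lemma colour_maps_compose: "f \<in> colour_maps U V \<Longrightarrow> g \<in> colour_maps V W \<Longrightarrow> compose U g f \<in> colour_maps U W"
  unfolding colour_maps_def by (auto simp: compose_def) (metis PiE_mem fst_conv)+

lemma colour_maps_id: "restrict id V \<in> colour_maps V V"
  by (auto simp: colour_maps_def)

lemma colour_maps_eqI: "f \<in> colour_maps U V \<Longrightarrow> g \<in> colour_maps U W \<Longrightarrow> (\<And>x. x \<in> U \<Longrightarrow> f x = g x) \<Longrightarrow> f = g"
  by (auto simp: colour_maps_def PiE_def intro: extensionalityI)

lemma category_discrete_cat: "category (discrete_cat Col)"
proof
  fix f assume "f \<in> Arr (discrete_cat Col)"
  then show "Dom (discrete_cat Col) f \<in> Obj (discrete_cat Col)" "Cod (discrete_cat Col) f \<in> Obj (discrete_cat Col)"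
    by (cases f; simp)+
next
  fix f g U V W assume "f \<in> hom (discrete_cat Col) U V" "g \<in> hom (discrete_cat Col) V W"
  then show "g \<cdot>\<^bsub>discrete_cat Col\<^esub> f \<in> hom (discrete_cat Col) U W"
    by (auto elim!: discrete_homE intro!: discrete_homI colour_maps_compose)
next
  fix f V W assume "f \<in> hom (discrete_cat Col) V W"
  then obtain f' where f: "f = (V, f', W)" "f' \<in> colour_maps V W"
    by (rule discrete_homE)
  then have "compose V (restrict id W) f' = f'" "compose V f' (restrict id V) = f'"
    by (auto simp: colour_maps_def PiE_def Pi_def compose_def extensional_def restrict_def fun_eq_iff)
  then show "Ide (discrete_cat Col) W \<cdot>\<^bsub>discrete_cat Col\<^esub> f = f" "f \<cdot>\<^bsub>discrete_cat Col\<^esub> Ide (discrete_cat Col) V = f"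
    by (simp_all add: f)
next
  fix f g k U V W X
  assume "f \<in> hom (discrete_cat Col) U V" "g \<in> hom (discrete_cat Col) V W" "k \<in> hom (discrete_cat Col) W X"
  then show "k \<cdot>\<^bsub>discrete_cat Col\<^esub> g \<cdot>\<^bsub>discrete_cat Col\<^esub> f = k \<cdot>\<^bsub>discrete_cat Col\<^esub> (g \<cdot>\<^bsub>discrete_cat Col\<^esub> f)"
    by (auto elim!: discrete_homE simp: colour_maps_def intro!: compose_assoc[symmetric])
next
  fix X assume "X \<in> Obj (discrete_cat Col)"
  then show "Ide (discrete_cat Col) X \<in> hom (discrete_cat Col) X X"
    by (auto intro: discrete_homI colour_maps_id)
qed

lemma empty_map_simps: "f \<in> colour_maps {} W \<Longrightarrow> f = (\<lambda>x. undefined)" "(\<lambda>x. undefined) \<in> colour_maps {} W"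
  by (auto simp: colour_maps_def)

text \<open>Injectivity is tested by a single vertex: points with the same image have the same
  colour, and picking either of them is an arrow from the one-vertex graph of that colour.\<close>

lemma monic_discrete_iff:
  "monic (discrete_cat Col) (V, f, W) \<longleftrightarrow> (V, f, W) \<in> Arr (discrete_cat Col) \<and> inj_on f V"
proof (intro iffI conjI)
  interpret category "discrete_cat Col" by (rule category_discrete_cat)
  assume m: "monic (discrete_cat Col) (V, f, W)"
  then show arr: "(V, f, W) \<in> Arr (discrete_cat Col)"
    by (simp add: monic_def)
  show "inj_on f V"
  proof (rule inj_onI)
    fix x y assume xy: "x \<in> V" "y \<in> V" "f x = f y"
    let ?Z = "{(fst x, 0::nat)}"
    have "fst y = fst x"
      using xy arr by (auto simp: colour_maps_def) metis
    then have hom: "(?Z, restrict (\<lambda>_. z) ?Z, V) \<in> hom (discrete_cat Col) ?Z V" if "z \<in> {x, y}" for z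
      using that xy arr by (intro discrete_homI) (auto simp: colour_maps_def)
    have eq: "compose ?Z f (restrict (\<lambda>_. x) ?Z) = compose ?Z f (restrict (\<lambda>_. y) ?Z)"
      using xy by (auto simp: compose_def)
    have "(?Z, restrict (\<lambda>_. x) ?Z, V) = (?Z, restrict (\<lambda>_. y) ?Z, V)"
      by (rule monicD[OF m]) (use homD[OF hom[of x]] homD[OF hom[of y]] eq in simp_all)
    then show "x = y"
      by (auto dest: fun_cong[where x = "(fst x, 0)"])
  qed
next
  assume m: "(V, f, W) \<in> Arr (discrete_cat Col) \<and> inj_on f V"
  show "monic (discrete_cat Col) (V, f, W)"
    unfolding monic_def
  proof (intro conjI allI ballI impI)
    fix Z a b
    assume "a \<in> hom (discrete_cat Col) Z (Dom (discrete_cat Col) (V, f, W))" "b \<in> hom (discrete_cat Col) Z (Dom (discrete_cat Col) (V, f, W))"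
      and eq: "(V, f, W) \<cdot>\<^bsub>discrete_cat Col\<^esub> a = (V, f, W) \<cdot>\<^bsub>discrete_cat Col\<^esub> b"
    then obtain g h where ab: "a = (Z, g, V)" "b = (Z, h, V)" and gh: "g \<in> colour_maps Z V" "h \<in> colour_maps Z V"
      by (auto elim!: discrete_homE)
    have "g x = h x" if "x \<in> Z" for x
    proof -
      have "f (g x) = f (h x)"
        using eq that by (auto simp: ab compose_def restrict_def dest: fun_cong[where x = x])
      then show ?thesis
        using m gh that by (auto simp: colour_maps_def dest: inj_onD)
    qed
    then show "a = b"
      using gh by (auto simp: ab intro: colour_maps_eqI)
  qed (use m in simp)
qed

text \<open>The concrete form of a coproduct of A and B, or of a pushout under the empty graph: P is
  the disjoint union of the two images.\<close>

definition jointly_bijective ::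
  "'c dgraph \<Rightarrow> ('c \<times> nat \<Rightarrow> 'c \<times> nat) \<Rightarrow> 'c dgraph \<Rightarrow> ('c \<times> nat \<Rightarrow> 'c \<times> nat) \<Rightarrow> 'c dgraph \<Rightarrow> bool"
  where "jointly_bijective A p B q P \<longleftrightarrow>
    p \<in> embeddings A P \<and> q \<in> embeddings B P \<and> p ` A \<inter> q ` B = {} \<and> p ` A \<union> q ` B = P"

text \<open>The universal property is tried on two targets. A disjoint union of copies of A and B
  forces injectivity and disjoint images; P with one additional vertex forces the images to cover
  P.\<close>

lemma discrete_pushout_imp_jointly_bijective:
  assumes po: "is_pushout (discrete_cat Col) (empty_map A) (empty_map B) (A, p, P) (B, q, P)"
  shows "jointly_bijective A p B q P"
proof -
  let ?C = "discrete_cat Col"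
  interpret category ?C by (rule category_discrete_cat)
  have A: "finite A" "A \<subseteq> Col \<times> UNIV" and B: "finite B" "B \<subseteq> Col \<times> UNIV"
    and P: "finite P" "P \<subseteq> Col \<times> UNIV" and p: "p \<in> colour_maps A P" and q: "q \<in> colour_maps B P"
    using is_pushoutD(3,4)[OF po] by auto
  have univ: "\<exists>!u. u \<in> hom ?C P T \<and> u \<cdot>\<^bsub>?C\<^esub> (A, p, P) = (A, p', T) \<and> u \<cdot>\<^bsub>?C\<^esub> (B, q, P) = (B, q', T)"
    if "T \<in> Obj ?C" "p' \<in> colour_maps A T" "q' \<in> colour_maps B T" for T p' q'
    using is_pushout_universal[OF po, of "(A, p', T)" T "(B, q', T)"] that A B
    by (simp add: empty_map_def hom_def compose_def restrict_def)
  \<comment> \<open>Vertices are named by colour and number, so disjoint copies with unchanged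
    colours arise by doubling the numbers and shifting one copy to the odd ones.\<close>
  let ?l = "\<lambda>(c :: 'a, m :: nat). (c, 2 * m)" and ?r = "\<lambda>(c :: 'a, m :: nat). (c, 2 * m + 1)"
  let ?T = "?l ` A \<union> ?r ` B"
  have T: "?T \<in> Obj ?C" "restrict ?l A \<in> colour_maps A ?T" "restrict ?r B \<in> colour_maps B ?T"
    using A B by (auto simp: colour_maps_def)
  obtain a where a: "a \<in> hom ?C P ?T" "a \<cdot>\<^bsub>?C\<^esub> (A, p, P) = (A, restrict ?l A, ?T)"
      "a \<cdot>\<^bsub>?C\<^esub> (B, q, P) = (B, restrict ?r B, ?T)"
    using univ[OF T] by blast
  obtain u where "a = (P, u, ?T)"
    using a(1) by (rule discrete_homE)
  with a(2,3) have "compose A u p = restrict ?l A" "compose B u q = restrict ?r B"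
    by simp_all
  note u = this
  have up: "u (p x) = ?l x" if "x \<in> A" for x
    using that fun_cong[OF u(1), of x] by (simp add: compose_def)
  have uq: "u (q x) = ?r x" if "x \<in> B" for x
    using that fun_cong[OF u(2), of x] by (simp add: compose_def)
  have l: "inj ?l" "inj ?r" and lr: "?l x \<noteq> ?r y" for x y
    by (auto simp: inj_on_def split: prod.splits) presburger
  have "inj_on p A"
    using up l(1) by (metis (no_types, lifting) inj_onI injD)
  moreover have "inj_on q B"
    using uq l(2) by (metis (no_types, lifting) inj_onI injD)
  moreover have "p ` A \<inter> q ` B = {}"
    using up uq lr by (smt (verit) disjoint_iff image_iff)
  moreover have "P \<subseteq> p ` A \<union> q ` B"
  proof (rule ccontr)
    assume "\<not> P \<subseteq> p ` A \<union> q ` B"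
    then obtain x where x: "x \<in> P" "x \<notin> p ` A" "x \<notin> q ` B" by blast
    \<comment> \<open>A fresh name for a second vertex of the colour of x; finiteness of P provides
      the number.\<close>
    obtain N where N: "(fst x, N) \<notin> P"
    proof -
      have "finite (snd ` P)" using P by simp
      then obtain N where "N \<notin> snd ` P" using ex_new_if_finite[OF infinite_UNIV_nat] by blast
      then show ?thesis using that by force
    qed
    let ?T = "insert (fst x, N) P"
    \<comment> \<open>The two maps agree on the images of p and q but differ at the uncovered x,
      against uniqueness of the mediating arrow.\<close>
    let ?u = "restrict id P" and ?v = "restrict (id(x := (fst x, N))) P"
    have T: "?T \<in> Obj ?C" "p \<in> colour_maps A ?T" "q \<in> colour_maps B ?T"
      using P p q x by (auto simp: colour_maps_def)
    have "(P, ?u, ?T) \<in> hom ?C P ?T" "(P, ?v, ?T) \<in> hom ?C P ?T"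
      using P T x by (auto intro!: discrete_homI simp: colour_maps_def)
    moreover have "compose A ?u p = p" "compose A ?v p = p" "compose B ?u q = q" "compose B ?v q = q"
      using p q x by (auto simp: compose_def colour_maps_def PiE_def Pi_def extensional_def restrict_def fun_eq_iff)
    ultimately have "(P, ?u, ?T) = (P, ?v, ?T)"
      using univ[OF T] by (metis discrete_cat_simps(6))
    then have "?u x = ?v x" by (metis Pair_inject)
    then show False
      using x N by auto
  qed
  ultimately show ?thesis
    using p q by (auto simp: jointly_bijective_def embeddings_def colour_maps_def)
qed

lemma jointly_bijective_imp_discrete_pushout:
  assumes A: "A \<in> Obj (discrete_cat Col)" and B: "B \<in> Obj (discrete_cat Col)" and P: "P \<in> Obj (discrete_cat Col)"
    and jb: "jointly_bijective A p B q P"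
  shows "is_pushout (discrete_cat Col) (empty_map A) (empty_map B) (A, p, P) (B, q, P)"
proof -
  let ?C = "discrete_cat Col"
  have p: "p \<in> colour_maps A P" "inj_on p A" and q: "q \<in> colour_maps B P" "inj_on q B"
    and disj: "p ` A \<inter> q ` B = {}" and cover: "p ` A \<union> q ` B = P"
    using jb by (auto simp: jointly_bijective_def embeddings_def)
  show ?thesis
    unfolding is_pushout_def
  proof (intro conjI allI ballI impI)
    fix T a b
    assume "a \<in> hom ?C (Cod ?C (empty_map A)) T" "b \<in> hom ?C (Cod ?C (empty_map B)) T"
    then obtain p' q' where ab: "a = (A, p', T)" "b = (B, q', T)" and p'q': "p' \<in> colour_maps A T" "q' \<in> colour_maps B T"
      and T: "T \<in> Obj ?C"
      by (auto simp: empty_map_def elim!: discrete_homE)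
    \<comment> \<open>Injectivity lets p and q be inverted on their images, disjointness makes the
      case distinction consistent with q, and covering leaves no other choice.\<close>
    let ?u = "\<lambda>x \<in> P. if x \<in> p ` A then p' (inv_into A p x) else q' (inv_into B q x)"
    have up: "?u (p x) = p' x" if "x \<in> A" for x
      using that p cover by auto
    have uq: "?u (q x) = q' x" if "x \<in> B" for x
      using that q cover disj by auto
    have u: "?u \<in> colour_maps P T"
      unfolding colour_maps_def
    proof (intro CollectI conjI ballI PiE_I)
      fix x assume "x \<in> P"
      then consider y where "y \<in> A" "x = p y" | y where "y \<in> B" "x = q y"
        using cover by blast
      then have "?u x \<in> T \<and> fst (?u x) = fst x"
        using p q p'q' up uq by cases (auto simp: colour_maps_def)
      then show "?u x \<in> T" "fst (?u x) = fst x" by auto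
    qed auto
    have comp: "compose A ?u p = p'" "compose B ?u q = q'"
      using p q p'q' u up uq by (auto intro!: colour_maps_eqI[OF colour_maps_compose] simp: compose_eq simp del: restrict_apply)
    show "\<exists>!x. x \<in> hom ?C (Cod ?C (A, p, P)) T \<and> x \<cdot>\<^bsub>?C\<^esub> (A, p, P) = a \<and> x \<cdot>\<^bsub>?C\<^esub> (B, q, P) = b"
    proof (rule ex1I[of _ "(P, ?u, T)"])
      show "(P, ?u, T) \<in> hom ?C (Cod ?C (A, p, P)) T \<and> (P, ?u, T) \<cdot>\<^bsub>?C\<^esub> (A, p, P) = a \<and> (P, ?u, T) \<cdot>\<^bsub>?C\<^esub> (B, q, P) = b"
        using discrete_homI[OF u P T] by (simp add: ab comp del: discrete_cat_simps(1))
      fix x assume x: "x \<in> hom ?C (Cod ?C (A, p, P)) T \<and> x \<cdot>\<^bsub>?C\<^esub> (A, p, P) = a \<and> x \<cdot>\<^bsub>?C\<^esub> (B, q, P) = b"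
      then obtain v where v: "x = (P, v, T)" "v \<in> colour_maps P T"
        by (auto elim: discrete_homE)
      have "compose A v p = p'" "compose B v q = q'"
        using x by (simp_all add: v ab)
      then have vp: "v (p y) = p' y" if "y \<in> A" for y
        using that by (metis compose_eq)
      have vq: "v (q y) = q' y" if "y \<in> B" for y
        using that \<open>compose B v q = q'\<close> by (metis compose_eq)
      have "v y = ?u y" if "y \<in> P" for y
      proof -
        consider z where "z \<in> A" "y = p z" | z where "z \<in> B" "y = q z"
          using \<open>y \<in> P\<close> cover by blast
        then show ?thesis
          by cases (simp_all only: up uq vp vq)
      qed
      then have "v = ?u"
        using v(2) u by (intro colour_maps_eqI[of v P T ?u T])
      then show "x = (P, ?u, T)"
        by (simp add: v)
    qed
  qed (use A B P p q in \<open>simp_all add: empty_map_def compose_def restrict_def empty_map_simps\<close>)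
qed

lemma colour_count_jointly_bijective:
  assumes "jointly_bijective A p B q P" "finite P"
  shows "colour_count P c = colour_count A c + colour_count B c"
proof -
  have p: "p \<in> embeddings A P" and q: "q \<in> embeddings B P"
    and disj: "p ` A \<inter> q ` B = {}" and cover: "p ` A \<union> q ` B = P"
    using assms by (auto simp: jointly_bijective_def)
  have "{x \<in> P. fst x = c} = p ` {x \<in> A. fst x = c} \<union> q ` {x \<in> B. fst x = c}"
    using p q by (auto simp: embeddings_def colour_maps_def simp flip: cover)
  moreover have "card \<dots> = card (p ` {x \<in> A. fst x = c}) + card (q ` {x \<in> B. fst x = c})"
    using disj assms(2) cover by (intro card_Un_disjoint) (auto intro: finite_subset[of _ P])
  ultimately show ?thesis
    using embedding_fibre(2)[OF p assms(2)] embedding_fibre(2)[OF q assms(2)] by (simp add: colour_count_def)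
qed

text \<open>Colour counts are the only obstruction: for each colour a bijection from the tagged sum
  of the fibres of A and B onto the fibre of P exists, and these are glued.\<close>

lemma ex_jointly_bijective:
  assumes A: "finite A" "A \<subseteq> Col \<times> UNIV" and B: "finite B" "B \<subseteq> Col \<times> UNIV"
    and P: "finite P" "P \<subseteq> Col \<times> UNIV"
    and count: "\<And>c. c \<in> Col \<Longrightarrow> colour_count P c = colour_count A c + colour_count B c"
  shows "\<exists>p q. jointly_bijective A p B q P"
proof -
  let ?A = "\<lambda>c. {x \<in> A. fst x = c}" and ?B = "\<lambda>c. {x \<in> B. fst x = c}" and ?P = "\<lambda>c. {x \<in> P. fst x = c}"
  have "\<exists>g. bij_betw g (?A c <+> ?B c) (?P c)" if "c \<in> Col" for c
    using count[OF that] A B P by (intro finite_same_card_bij) (auto simp: card_Plus colour_count_def)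
  then have "\<forall>c \<in> Col. \<exists>g. bij_betw g (?A c <+> ?B c) (?P c)" by blast
  then obtain g where "\<forall>c \<in> Col. bij_betw (g c) (?A c <+> ?B c) (?P c)"
    by (rule bchoice[THEN exE])
  then have g: "\<And>c. c \<in> Col \<Longrightarrow> bij_betw (g c) (?A c <+> ?B c) (?P c)"
    by blast
  have A': "x \<in> A \<Longrightarrow> fst x \<in> Col" and B': "x \<in> B \<Longrightarrow> fst x \<in> Col" and P': "x \<in> P \<Longrightarrow> fst x \<in> Col" for x
    using A B P by auto
  let ?p = "\<lambda>x \<in> A. g (fst x) (Inl x)" and ?q = "\<lambda>x \<in> B. g (fst x) (Inr x)"
  have p: "?p x \<in> P" "fst (?p x) = fst x" if "x \<in> A" for x
    using bij_betwE[OF g[OF A'[OF that]]] that by (auto simp: InlI)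
  have q: "?q x \<in> P" "fst (?q x) = fst x" if "x \<in> B" for x
    using bij_betwE[OF g[OF B'[OF that]]] that by (auto simp: InrI)
  have g_inj: "y = z" if "g c y = g c z" "y \<in> ?A c <+> ?B c" "z \<in> ?A c <+> ?B c" "c \<in> Col" for c y z
    using that bij_betw_imp_inj_on[OF g[of c]] by (auto dest: inj_onD)
  have "inj_on ?p A"
  proof (rule inj_onI)
    fix x y assume xy: "x \<in> A" "y \<in> A" "?p x = ?p y"
    then have "fst x = fst y" by (metis p(2))
    with xy show "x = y" using g_inj[of "fst x" "Inl x" "Inl y"] A' by auto
  qed
  moreover have "inj_on ?q B"
  proof (rule inj_onI)
    fix x y assume xy: "x \<in> B" "y \<in> B" "?q x = ?q y"
    then have "fst x = fst y" by (metis q(2))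
    with xy show "x = y" using g_inj[of "fst x" "Inr x" "Inr y"] B' by auto
  qed
  moreover have "?p ` A \<inter> ?q ` B = {}"
  proof (rule ccontr)
    assume "?p ` A \<inter> ?q ` B \<noteq> {}"
    then obtain x y where xy: "x \<in> A" "y \<in> B" and eq: "?p x = ?q y"
      by blast
    then have "fst x = fst y" using xy by (metis p(2) q(2))
    with xy eq show False using g_inj[of "fst x" "Inl x" "Inr y"] A'[of x] by (auto simp: InlI InrI)
  qed
  moreover have "?p ` A \<union> ?q ` B = P"
  proof
    show "?p ` A \<union> ?q ` B \<subseteq> P"
      using p(1) q(1) by blast
    show "P \<subseteq> ?p ` A \<union> ?q ` B"
    proof
      fix x assume x: "x \<in> P"
      then have "x \<in> g (fst x) ` (?A (fst x) <+> ?B (fst x))"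
        using bij_betw_imp_surj_on[OF g[OF P'[OF x]]] by auto
      then obtain y where y: "y \<in> ?A (fst x) <+> ?B (fst x)" "x = g (fst x) y" by blast
      then show "x \<in> ?p ` A \<union> ?q ` B"
      proof (cases y)
        case (Inl z)
        then have "z \<in> A" "x = ?p z"
          using y by auto
        then show ?thesis by blast
      next
        case (Inr z)
        then have "z \<in> B" "x = ?q z"
          using y by auto
        then show ?thesis by blast
      qed
    qed
  qed
  moreover have maps: "?p \<in> colour_maps A P" "?q \<in> colour_maps B P"
    unfolding colour_maps_def using p q by (simp_all add: Pi_def del: split_paired_All)
  ultimately have "jointly_bijective A ?p B ?q P"
    using maps unfolding jointly_bijective_def embeddings_def by blast
  then show ?thesis by blast
qed

section \<open>Rewriting of discrete graphs\<close>

lemma empty_map_cases: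
  assumes "a \<in> Arr (discrete_cat Col)" "Dom (discrete_cat Col) a = {}"
  shows "a = empty_map (Cod (discrete_cat Col) a)"
  using assms by (cases a) (auto simp: empty_map_def empty_map_simps)

lemma empty_map_dom_cod [simp]:
  "Dom (discrete_cat Col) (empty_map W) = {}" "Cod (discrete_cat Col) (empty_map W) = W"
  by (simp_all add: empty_map_def)

text \<open>The context leg d shares the empty domain of the input leg, so every rewriting square of
  a discrete rule is a disjoint union.\<close>

lemma discrete_pushout_empty_mapE:
  assumes "is_pushout (discrete_cat Col) (empty_map A) d m e"
  obtains B p q P where "d = empty_map B" "m = (A, p, P)" "e = (B, q, P)"
    "finite B" "B \<subseteq> Col \<times> UNIV" "finite P" "P \<subseteq> Col \<times> UNIV" "jointly_bijective A p B q P"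
proof -
  interpret category "discrete_cat Col" by (rule category_discrete_cat)
  note po = is_pushoutD[OF assms]
  obtain B where d: "d = empty_map B"
    using po(2,5) by (auto dest: empty_map_cases)
  obtain p P where m: "m = (A, p, P)"
    using po(6) by (cases m) auto
  obtain q where e: "e = (B, q, P)"
    using po(7,8) by (cases e) (auto simp: d m)
  show ?thesis
  proof (rule that[OF d m e])
    show "jointly_bijective A p B q P"
      using assms discrete_pushout_imp_jointly_bijective by (simp add: d m e)
  qed (use po(4) in \<open>simp_all add: e\<close>)
qed

text \<open>The vertices outside the image form the pushout complement.\<close>

lemma embedding_jointly_bijective:
  assumes "p \<in> embeddings A P"
  shows "jointly_bijective A p (P - p ` A) (restrict id (P - p ` A)) P"
  using assms by (auto simp: jointly_bijective_def embeddings_def colour_maps_def)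

lemma matches_discrete:
  assumes L: "finite L" "L \<subseteq> Col \<times> UNIV" and X: "finite X" "X \<subseteq> Col \<times> UNIV"
    and i: "i = empty_map L \<or> i = Ide (discrete_cat Col) L"
  shows "matches (discrete_cat Col) (a, i) X = (\<lambda>f. (L, f, X)) ` embeddings L X"
proof -
  let ?C = "discrete_cat Col"
  interpret category ?C by (rule category_discrete_cat)
  have Cod: "Cod ?C i = L"
    using i by auto
  have hom: "m \<in> hom ?C L X \<and> monic ?C m \<longleftrightarrow> m \<in> (\<lambda>f. (L, f, X)) ` embeddings L X" for m
    using L X by (cases m) (auto simp: hom_def monic_discrete_iff embeddings_def)
  have "\<exists>d e. is_pushout ?C i d (L, f, X) e" if f: "f \<in> embeddings L X" for f
    using i
  proof
    let ?D = "X - f ` L"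
    assume "i = empty_map L"
    moreover have "is_pushout ?C (empty_map L) (empty_map ?D) (L, f, X) (?D, restrict id ?D, X)"
      using L X by (intro jointly_bijective_imp_discrete_pushout embedding_jointly_bijective f) auto
    ultimately show ?thesis by blast
  next
    assume i: "i = Ide ?C L"
    have "(L, f, X) \<in> Arr ?C"
      using L X f by (simp add: embeddings_def)
    from is_pushout_Ide[OF this] have "is_pushout ?C i (L, f, X) (L, f, X) (Ide ?C X)"
      by (simp add: i)
    then show ?thesis by blast
  qed
  then have "m \<in> (\<lambda>f. (L, f, X)) ` embeddings L X \<longleftrightarrow> m \<in> hom ?C L X \<and> monic ?C m \<and> (\<exists>d e. is_pushout ?C i d m e)" for m
    unfolding hom[symmetric, of m] conj_assoc[symmetric] using hom[of m] by blast
  then show ?thesis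
    unfolding matches_def snd_conv Cod by blast
qed

lemma card_matches_discrete:
  assumes "finite L" "L \<subseteq> Col \<times> UNIV" "finite X" "X \<subseteq> Col \<times> UNIV"
    and "i = empty_map L \<or> i = Ide (discrete_cat Col) L" and Col: "finite Col"
  shows "real (card (matches (discrete_cat Col) (a, i) X)) =
    (\<Prod>c \<in> Col. falling (real (colour_count X c)) (colour_count L c))"
proof -
  have "card (matches (discrete_cat Col) (a, i) X) = card (embeddings L X)"
    by (subst matches_discrete[OF assms(1-5)]) (auto intro!: card_image simp: inj_on_def)
  then show ?thesis
    using card_embeddings[OF Col assms(1-3)] by simp
qed

lemma discrete_graph_Obj: "finite Col \<Longrightarrow> discrete_graph Col n \<in> Obj (discrete_cat Col)"
proof -
  assume "finite Col"
  have "discrete_graph Col n = (SIGMA c:Col. {..<n c})"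
    by (auto simp: discrete_graph_def)
  then show ?thesis
    using \<open>finite Col\<close> by auto
qed

lemma colour_count_discrete_graph:
  assumes "c \<in> Col"
  shows "colour_count (discrete_graph Col n) c = n c"
proof -
  have "{x \<in> discrete_graph Col n. fst x = c} = Pair c ` {..<n c}"
    using assms by (auto simp: discrete_graph_def)
  then show ?thesis
    by (simp add: colour_count_def card_image inj_on_def)
qed

text \<open>W is isomorphic to V exactly if it is a disjoint union of the empty graph and V. In this
  form both directions follow from the results on pushouts.\<close>

lemma iso_obj_discrete_iff:
  assumes V: "V \<in> Obj (discrete_cat Col)" and W: "W \<in> Obj (discrete_cat Col)"
  shows "iso_obj (discrete_cat Col) V W \<longleftrightarrow> (\<forall>c \<in> Col. colour_count V c = colour_count W c)"
proof
  let ?C = "discrete_cat Col"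
  interpret category ?C by (rule category_discrete_cat)
  have jb: "jointly_bijective {} (\<lambda>x. undefined) U (restrict id U) U" for U
    by (auto simp: jointly_bijective_def embeddings_def colour_maps_def)
  {
    assume "iso_obj ?C V W"
    then obtain u v where uv: "inverse_arrs u v" "Dom ?C u = V" "Cod ?C u = W"
      by (auto simp: iso_obj_iff_inverse_arrs)
    have "is_pushout ?C (empty_map {}) (empty_map V) ({}, \<lambda>x. undefined, V) (V, restrict id V, V)"
      using V by (intro jointly_bijective_imp_discrete_pushout jb) auto
    from is_pushout_Comp_inverse[OF this uv(1)]
    have "is_pushout ?C (empty_map {}) (empty_map V) (u \<cdot>\<^bsub>?C\<^esub> ({}, \<lambda>x. undefined, V)) (u \<cdot>\<^bsub>?C\<^esub> (V, restrict id V, V))"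
      by (simp add: uv(2))
    moreover obtain f where "u = (V, f, W)"
      using uv(2,3) by (cases u) auto
    ultimately obtain p q where "jointly_bijective {} p V q W"
      by (auto dest!: discrete_pushout_imp_jointly_bijective)
    then show "\<forall>c \<in> Col. colour_count V c = colour_count W c"
      using W colour_count_jointly_bijective[of "{}" p V q W] by (simp add: colour_count_def)
  next
    assume count: "\<forall>c \<in> Col. colour_count V c = colour_count W c"
    then have "\<exists>p q. jointly_bijective {} p V q W"
      using V W by (intro ex_jointly_bijective[where Col = Col]) (auto simp: colour_count_def)
    then obtain p q where "jointly_bijective {} p V q W" by blast
    then have "is_pushout ?C (empty_map {}) (empty_map V) ({}, p, W) (V, q, W)"
      using V W by (intro jointly_bijective_imp_discrete_pushout) auto
    moreover have "is_pushout ?C (empty_map {}) (empty_map V) ({}, \<lambda>x. undefined, V) (V, restrict id V, V)"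
      using V by (intro jointly_bijective_imp_discrete_pushout jb) auto
    ultimately show "iso_obj ?C V W"
      using is_pushout_unique by fastforce
  }
qed

text \<open>With context graph D the counts satisfy X = k + D and Y = n + D; the condition is
  written additively since subtraction of naturals truncates. Conversely, a graph with the right
  counts is a disjoint union of the output and the same D.\<close>

lemma rewrite_class_discrete:
  assumes Col: "finite Col" and X: "X \<in> Obj (discrete_cat Col)"
    and m: "m \<in> matches (discrete_cat Col) (discrete_rule Col n k) X"
  shows "rewrite_class (discrete_cat Col) (discrete_rule Col n k) m =
      {Y \<in> Obj (discrete_cat Col). \<forall>c \<in> Col. colour_count Y c + k c = colour_count X c + n c}" (is "_ = ?Z")
    and "\<forall>c \<in> Col. k c \<le> colour_count X c"
proof -
  let ?C = "discrete_cat Col" and ?I = "discrete_graph Col k" and ?O = "discrete_graph Col n"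
  note Obj = discrete_graph_Obj[OF Col]
  note count = colour_count_discrete_graph
  have hom: "m \<in> hom ?C ?I X" and ex: "\<exists>d e. is_pushout ?C (empty_map ?I) d m e"
    using m by (auto simp: matches_def discrete_rule_def)
  then have CodX: "Cod ?C m = X"
    by (simp add: hom_def)
  have in_count: "colour_count X c = k c + colour_count (Cod ?C d) c"
    if "is_pushout ?C (empty_map ?I) d m e" "c \<in> Col" for d e c
    using that CodX by (auto elim!: discrete_pushout_empty_mapE simp: colour_count_jointly_bijective count)
  then show "\<forall>c \<in> Col. k c \<le> colour_count X c"
    using ex by fastforce
  show "rewrite_class ?C (discrete_rule Col n k) m = ?Z"
  proof (intro equalityI subsetI)
    fix Y assume "Y \<in> rewrite_class ?C (discrete_rule Col n k) m"
    then obtain d e m' e' where po: "is_pushout ?C (empty_map ?I) d m e" "is_pushout ?C (empty_map ?O) d m' e'"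
      and Y: "Y = Cod ?C m'"
      by (auto simp: rewrite_class_def discrete_rule_def)
    have "colour_count Y c = n c + colour_count (Cod ?C d) c" if "c \<in> Col" for c
      using po(2) that Y by (auto elim!: discrete_pushout_empty_mapE simp: colour_count_jointly_bijective count)
    moreover have "Y \<in> Obj ?C"
      using po(2) Y by (auto elim!: discrete_pushout_empty_mapE)
    ultimately show "Y \<in> ?Z"
      using in_count[OF po(1)] by simp
  next
    fix Y assume Y: "Y \<in> ?Z"
    obtain d e where po: "is_pushout ?C (empty_map ?I) d m e"
      using ex by blast
    then obtain D where D: "d = empty_map D" "D \<in> Obj ?C"
      by (auto elim!: discrete_pushout_empty_mapE)
    have "colour_count Y c = colour_count ?O c + colour_count D c" if "c \<in> Col" for c
    proof -
      have "colour_count Y c + k c = colour_count X c + n c"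
        using Y that by blast
      then show ?thesis
        using in_count[OF po that] that by (simp add: count D(1))
    qed
    then obtain p q where "jointly_bijective ?O p D q Y"
      using Y D(2) Obj[of n] ex_jointly_bijective[of ?O Col D Y] by auto
    then have out_po: "is_pushout ?C (empty_map ?O) d (?O, p, Y) (D, q, Y)"
      using Y D Obj[of n] by (simp only: D(1)) (intro jointly_bijective_imp_discrete_pushout, auto)
    have "Y = Cod ?C (?O, p, Y)"
      by simp
    with po out_po show "Y \<in> rewrite_class ?C (discrete_rule Col n k) m"
      unfolding rewrite_class_def discrete_rule_def fst_conv snd_conv by blast
  qed
qed

lemma rewrite_class_discrete_obj_classes:
  assumes Col: "finite Col" and X: "X \<in> Obj (discrete_cat Col)"
    and m: "m \<in> matches (discrete_cat Col) (discrete_rule Col n k) X"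
  shows "rewrite_class (discrete_cat Col) (discrete_rule Col n k) m \<in> obj_classes (discrete_cat Col)" (is "?R \<in> _")
    and "c \<in> Col \<Longrightarrow> colour_count (rep (rewrite_class (discrete_cat Col) (discrete_rule Col n k) m)) c + k c =
      colour_count X c + n c"
proof -
  let ?C = "discrete_cat Col"
  interpret category ?C by (rule category_discrete_cat)
  note R = rewrite_class_discrete[OF assms]
  \<comment> \<open>An explicit member of the class; the subtraction is exact since a match forces
    \<open>k c \<le> colour_count X c\<close>.\<close>
  let ?Y = "discrete_graph Col (\<lambda>c. colour_count X c - k c + n c)"
  note Y = discrete_graph_Obj[OF Col]
  have "(\<forall>c \<in> Col. colour_count V c + k c = colour_count X c + n c) \<longleftrightarrow>
      (\<forall>c \<in> Col. colour_count ?Y c = colour_count V c)" for V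
  proof (intro ball_cong refl)
    fix c assume c: "c \<in> Col"
    then have "k c \<le> colour_count X c"
      using R(2) by blast
    then show "colour_count V c + k c = colour_count X c + n c \<longleftrightarrow> colour_count ?Y c = colour_count V c"
      using c by (auto simp: colour_count_discrete_graph)
  qed
  then have "?R = obj_class ?C ?Y"
    unfolding R(1) obj_class_def by (intro Collect_cong conj_cong refl) (simp only: iso_obj_discrete_iff[OF Y])
  then show *: "?R \<in> obj_classes ?C"
    using Y by (auto simp: obj_classes_def)
  show "colour_count (rep ?R) c + k c = colour_count X c + n c" if "c \<in> Col"
    using rep_obj_class(1)[OF *] that by (auto simp: R(1))
qed

lemma linear_rule_discrete_rule: "finite Col \<Longrightarrow> linear_rule (discrete_cat Col) (discrete_rule Col n k)"
  using discrete_graph_Obj[of Col n] discrete_graph_Obj[of Col k]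
  by (auto simp: linear_rule_def discrete_rule_def empty_map_def monic_discrete_iff empty_map_simps)

section \<open>Vertex-counting observables\<close>

lemma vertex_count_eq:
  assumes "finite Col" "c \<in> Col"
  shows "vertex_count Col c = lin_ext (obj_classes (discrete_cat Col))
    (\<lambda>X. real (colour_count (rep X) c) *\<^sub>R Poly_Mapping.single X 1)"
proof -
  let ?C = "discrete_cat Col" and ?V = "discrete_graph Col (\<lambda>c'. if c' = c then 1 else 0)"
  interpret category ?C by (rule category_discrete_cat)
  have V: "?V \<in> Obj ?C"
    using assms(1) by (rule discrete_graph_Obj)
  have r: "linear_rule ?C (Ide ?C ?V, Ide ?C ?V)"
    using V by (simp add: linear_rule_def monic_Ide del: discrete_cat_simps)
  have "real (card (matches ?C (Ide ?C ?V, Ide ?C ?V) (rep X))) = real (colour_count (rep X) c)"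
    if "X \<in> obj_classes ?C" for X
  proof -
    have "real (card (matches ?C (Ide ?C ?V, Ide ?C ?V) (rep X))) =
        (\<Prod>c' \<in> Col. falling (real (colour_count (rep X) c')) (colour_count ?V c'))"
      using V rep_obj_class(2)[OF that] assms(1) by (intro card_matches_discrete) auto
    \<comment> \<open>The input has one vertex of colour c and none of the others:
      \<open>falling x 1\<close> is x and \<open>falling x 0\<close> is 1.\<close>
    also have "\<dots> = (\<Prod>c' \<in> Col. if c' = c then real (colour_count (rep X) c') else 1)"
      by (intro prod.cong) (auto simp: colour_count_discrete_graph falling_def)
    finally show ?thesis
      using assms by simp
  qed
  then show ?thesis
    unfolding vertex_count_def Let_def obs_delta[OF r]
    by (intro ext lin_ext_cong) auto
qed

lemma lookup_vertex_count:
  assumes "finite Col" "c \<in> Col"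
  shows "Poly_Mapping.lookup (vertex_count Col c v) X =
    (if X \<in> obj_classes (discrete_cat Col) then real (colour_count (rep X) c) * Poly_Mapping.lookup v X else 0)"
  by (simp add: vertex_count_eq[OF assms] lin_ext_diagonal_lookup)

lemma colour_count_rep_obj_class:
  assumes V: "V \<in> Obj (discrete_cat Col)" and c: "c \<in> Col"
  shows "colour_count (rep (obj_class (discrete_cat Col) V)) c = colour_count V c"
proof -
  interpret category "discrete_cat Col" by (rule category_discrete_cat)
  have "obj_class (discrete_cat Col) V \<in> obj_classes (discrete_cat Col)"
    using V by (auto simp: obj_classes_def)
  then have "rep (obj_class (discrete_cat Col) V) \<in> obj_class (discrete_cat Col) V"
    by (rule rep_obj_class)
  then show ?thesis
    using V c iso_obj_discrete_iff[OF V] by (auto simp: obj_class_def)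
qed

text \<open>A coproduct is a pushout under the empty graph, hence a partition of the single vertex,
  of which one part is empty.\<close>

lemma connected_obj_single_vertex:
  assumes "c \<in> Col"
  shows "connected_obj (discrete_cat Col) {(c, 0)}"
proof -
  let ?C = "discrete_cat Col"
  interpret category ?C by (rule category_discrete_cat)
  have initial: "is_initial ?C {}"
    unfolding is_initial_def
  proof (intro conjI ballI)
    fix X assume "X \<in> Obj ?C"
    then show "\<exists>!f. f \<in> hom ?C {} X"
      using empty_map_simps(1)
      by (intro ex1I[of _ "empty_map X"])
        (auto simp: empty_map_def empty_map_simps(2) hom_def elim!: discrete_homE)
  qed simp
  have "\<not> is_initial ?C {(c, 0)}"
  proof
    assume "is_initial ?C {(c, 0)}"
    then obtain f where "f \<in> hom ?C {(c, 0)} {}"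
      unfolding is_initial_def by (metis discrete_cat_simps(1) finite.emptyI empty_subsetI)
    then show False
      by (auto elim!: discrete_homE simp: colour_maps_def)
  qed
  moreover have "is_initial ?C (Dom ?C a) \<or> is_initial ?C (Dom ?C b)"
    if co: "is_coproduct ?C a b" and cod: "Cod ?C a = {(c, 0)}" for a b
  proof -
    obtain A p where a: "a = (A, p, {(c, 0)})"
      using cod by (cases a) auto
    obtain B q where b: "b = (B, q, {(c, 0)})"
      using cod co by (cases b) (auto simp: is_coproduct_def)
    have ab: "a \<in> Arr ?C" "b \<in> Arr ?C"
      using co by (auto simp: is_coproduct_def)
    have "is_pushout ?C (empty_map A) (empty_map B) a b"
      unfolding is_pushout_def
      using co ab by (auto simp: is_coproduct_def a b empty_map_simps empty_map_def compose_def restrict_def)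
    then have "jointly_bijective A p B q {(c, 0)}"
      unfolding a b by (rule discrete_pushout_imp_jointly_bijective)
    then have "A = {} \<or> B = {}"
      by (auto simp: jointly_bijective_def embeddings_def colour_maps_def)
    then show ?thesis
      using initial by (auto simp: a b)
  qed
  ultimately show ?thesis
    using assms by (auto simp: connected_obj_def)
qed

text \<open>Distinct colours give distinct operators: on the one-vertex state of colour c only the
  count of c is nonzero. The reindexing F admits both I and Col as index sets.\<close>

lemma connected_observables_vertex_count:
  assumes Col: "finite Col" and I: "finite I" and F: "inj_on F I" "F ` I \<subseteq> Col"
  shows "connected_observables (discrete_cat Col) I (vertex_count Col \<circ> F)"
proof -
  let ?C = "discrete_cat Col"
  interpret category ?C by (rule category_discrete_cat)
  have V: "discrete_graph Col (\<lambda>c'. if c' = c then 1 else 0) = {(c, 0)}" if "c \<in> Col" for c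
    using that by (auto simp: discrete_graph_def split: if_splits)
  have "inj_on (vertex_count Col) Col"
  proof (rule inj_onI, rule ccontr)
    fix c c' assume c: "c \<in> Col" "c' \<in> Col" "vertex_count Col c = vertex_count Col c'" "c \<noteq> c'"
    let ?V = "{(c, 0)}"
    let ?X = "obj_class ?C ?V"
    have "?X \<in> obj_classes ?C"
      using c by (auto simp: obj_classes_def)
    then have "Poly_Mapping.lookup (vertex_count Col d (Poly_Mapping.single ?X 1)) ?X = real (colour_count ?V d)"
      if "d \<in> Col" for d
      using c that by (simp add: lookup_vertex_count[OF Col] colour_count_rep_obj_class)
    from this[OF c(1)] this[OF c(2)] have "colour_count ?V c = colour_count ?V c'"
      using c(3) by simp
    moreover have "{x. x = (c, 0::nat) \<and> fst x = c} = {(c, 0)}" "{x. x = (c, 0::nat) \<and> fst x = c'} = {}"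
      using c(4) by auto
    ultimately show False
      by (simp add: colour_count_def)
  qed
  then have "inj_on (vertex_count Col \<circ> F) I"
    using F by (auto intro: comp_inj_on inj_on_subset)
  moreover have "connected_observable ?C (vertex_count Col c)" if "c \<in> Col" for c
  proof -
    let ?r = "(Ide ?C {(c, 0)}, Ide ?C {(c, 0)})"
    have Obj: "{(c, 0)} \<in> Obj ?C"
      using that by simp
    have "linear_rule ?C ?r"
      using Obj by (simp add: linear_rule_def monic_Ide del: discrete_cat_simps)
    moreover have "connected_obj ?C (Cod ?C (snd ?r))"
      using connected_obj_single_vertex[OF that] by simp
    moreover have "vertex_count Col c = obs ?C (delta ?C ?r)"
      by (simp add: vertex_count_def V[OF that] Let_def)
    ultimately show ?thesis
      unfolding connected_observable_def by blast
  qed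
  ultimately show ?thesis
    using I F by (auto simp: connected_observables_def)
qed

text \<open>Every result of the rule on X has its count of colour c shifted by
  \<open>n c - k c\<close>, so it is an eigenvector whose eigenvalue exceeds that of X by this
  amount; the commutator leaves the shift.\<close>

lemma ad_vertex_count_discrete_rule:
  assumes Col: "finite Col" and c: "c \<in> Col" and v: "v \<in> states (discrete_cat Col)"
  shows "ad (vertex_count Col c) (rho (discrete_cat Col) (delta (discrete_cat Col) (discrete_rule Col n k))) v =
    (real (n c) - real (k c)) *\<^sub>R rho (discrete_cat Col) (delta (discrete_cat Col) (discrete_rule Col n k)) v"
proof -
  let ?C = "discrete_cat Col" and ?r = "discrete_rule Col n k"
  interpret category ?C by (rule category_discrete_cat)
  let ?R = "rho ?C (delta ?C ?r)" and ?N = "vertex_count Col c"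
  have R: "linear ?R"
    using Col by (intro linear_rho_delta linear_rule_discrete_rule)
  have N: "linear ?N"
    using Col c by (simp add: vertex_count_eq linear_lin_ext)
  show ?thesis
  proof (rule linear_eq_on_states[OF _ _ v])
    show "linear (ad ?N ?R)"
      unfolding ad_def using linear_compose[OF R N] linear_compose[OF N R]
      by (intro linear_compose_sub) (simp_all add: o_def)
    show "linear (\<lambda>v. (real (n c) - real (k c)) *\<^sub>R ?R v)"
      by (intro linear_compose_scale_right R)
    fix X assume X: "X \<in> obj_classes ?C"
    have NX: "?N (Poly_Mapping.single X 1) = real (colour_count (rep X) c) *\<^sub>R Poly_Mapping.single X 1"
      if "X \<in> obj_classes ?C" for X
      using that Col c by (simp add: vertex_count_eq)
    have "?R (Poly_Mapping.single X 1) = rule_step ?r (rep X)"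
      using X by (simp add: rho_delta linear_rule_discrete_rule Col)
    moreover have "?N (rule_step ?r (rep X)) =
        (real (colour_count (rep X) c) + (real (n c) - real (k c))) *\<^sub>R rule_step ?r (rep X)"
    proof -
      have "?N (Poly_Mapping.single (rewrite_class ?C ?r m) 1) =
          (real (colour_count (rep X) c) + (real (n c) - real (k c))) *\<^sub>R Poly_Mapping.single (rewrite_class ?C ?r m) 1"
        if "m \<in> matches ?C ?r (rep X)" for m
        using rewrite_class_discrete_obj_classes[OF Col rep_obj_class(2)[OF X] that] c
        by (simp add: NX) (smt (verit) of_nat_add)
      then show ?thesis
        by (simp add: rule_step_def linear_sum[OF N] scaleR_sum_right)
    qed
    ultimately show "ad ?N ?R (Poly_Mapping.single X 1) = (real (n c) - real (k c)) *\<^sub>R ?R (Poly_Mapping.single X 1)"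
      by (simp add: ad_def NX[OF X] linear_scale[OF R] algebra_simps)
  qed
qed

text \<open>Matches are counted by falling factorials of the vertex counts, and these are the values
  of \<open>jump_poly\<close> once colours are renamed by F. The jump prefactor is 1.\<close>

lemma bra_rho_discrete_rule:
  assumes Col: "finite Col" and F: "bij_betw F I Col"
    and v: "v \<in> states (discrete_cat Col)"
    and l: "Poly_Mapping.keys l \<subseteq> I" "\<And>i. i \<in> I \<Longrightarrow> Poly_Mapping.lookup l i = k (F i)"
  shows "bra (rho (discrete_cat Col) (delta (discrete_cat Col) (discrete_rule Col n k)) v) =
    bra_poly I (vertex_count Col \<circ> F) (jump_poly I l) v"
proof -
  let ?C = "discrete_cat Col" and ?r = "discrete_rule Col n k"
  interpret category ?C by (rule category_discrete_cat)
  have FI: "F i \<in> Col" if "i \<in> I" for i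
    using F that by (auto simp: bij_betw_def)
  have I: "finite I"
    using F Col by (simp add: bij_betw_finite)
  have vk: "Poly_Mapping.keys v \<subseteq> obj_classes ?C"
    using v by (simp add: states_def)
  have card: "real (card (matches ?C ?r (rep X))) =
      (\<Prod>i \<in> I. falling (real (colour_count (rep X) (F i))) (Poly_Mapping.lookup l i))"
    if "X \<in> obj_classes ?C" for X
  proof -
    have "real (card (matches ?C ?r (rep X))) =
        (\<Prod>c \<in> Col. falling (real (colour_count (rep X) c)) (colour_count (discrete_graph Col k) c))"
      unfolding discrete_rule_def using rep_obj_class(2)[OF that] discrete_graph_Obj[OF Col, of k] Col
      by (intro card_matches_discrete) auto
    also have "\<dots> = (\<Prod>c \<in> Col. falling (real (colour_count (rep X) c)) (k c))"
      by (intro prod.cong) (simp_all add: colour_count_discrete_graph)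
    also have "\<dots> = (\<Prod>i \<in> I. falling (real (colour_count (rep X) (F i))) (k (F i)))"
      by (rule prod.reindex_bij_betw[OF F, symmetric])
    finally show ?thesis
      using l(2) by simp
  qed
  have "bra (rho ?C (delta ?C ?r) v) =
      (\<Sum>X \<in> Poly_Mapping.keys v. Poly_Mapping.lookup v X * real (card (matches ?C ?r (rep X))))"
    using vk by (simp add: rho_delta linear_rule_discrete_rule Col lin_ext_def rule_step_def
        linear_sum[OF linear_bra] linear_scale[OF linear_bra] Int_absorb2)
  also have "\<dots> = (\<Sum>X \<in> Poly_Mapping.keys v. Poly_Mapping.lookup v X *
      (\<Prod>i \<in> I. falling (real (colour_count (rep X) (F i))) (Poly_Mapping.lookup l i)))"
    using vk by (intro sum.cong) (auto simp: card)
  also have "\<dots> = bra_poly I (vertex_count Col \<circ> F) (jump_poly I l) v"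
    using vk FI by (intro bra_poly_jump_poly_diagonal[where A = "obj_classes ?C", symmetric] I l(1))
      (auto simp: lookup_vertex_count[OF Col])
  finally show ?thesis .
qed

text \<open>The bijection is kept general for two uses: indexed by I through F, to compare symbols,
  and indexed by Col through the identity, for jump-closure.\<close>

lemma conversion_symbol_discrete:
  assumes Col: "finite Col" and F: "bij_betw F I Col"
    and l: "\<And>j. j \<in> J \<Longrightarrow> Poly_Mapping.keys (l j) \<subseteq> I"
      "\<And>i j. i \<in> I \<Longrightarrow> j \<in> J \<Longrightarrow> Poly_Mapping.lookup (l j) i = k j (F i)"
    and e: "\<And>i j. i \<in> I \<Longrightarrow> j \<in> J \<Longrightarrow> e i j = real (n j (F i)) - real (k j (F i))"
  shows "conversion_symbol (discrete_cat Col) I (vertex_count Col \<circ> F)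
    (hamiltonian (discrete_cat Col) J \<kappa> (\<lambda>j. delta (discrete_cat Col) (discrete_rule Col (n j) (k j))))
    (evolution_symbol I J \<kappa> e l)"
proof -
  interpret category "discrete_cat Col" by (rule category_discrete_cat)
  have FI: "F i \<in> Col" if "i \<in> I" for i
    using F that by (auto simp: bij_betw_def)
  show ?thesis
  proof (rule conversion_symbol_hamiltonian)
    show "connected_observables (discrete_cat Col) I (vertex_count Col \<circ> F)"
      using F Col by (intro connected_observables_vertex_count) (auto simp: bij_betw_def dest: finite_imageD)
  qed (use Col F FI l e in \<open>auto simp: linear_rule_discrete_rule ad_vertex_count_discrete_rule bra_rho_discrete_rule\<close>)
qed

theorem theorem5p2:
  fixes C :: "('o, 'a) cat"
    and J :: "'j set" and \<kappa> :: "'j \<Rightarrow> real" and r :: "'j \<Rightarrow> 'a rule" and h :: "'j \<Rightarrow> 'a rule_algebra"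
    and H :: "'o operator"
    and I :: "'i set" and Ob :: "'i \<Rightarrow> 'o operator"
    and \<eta> :: "'i \<Rightarrow> 'j \<Rightarrow> int" and \<alpha> :: "'j \<Rightarrow> real" and k :: "'j \<Rightarrow> 'i multi_index"
    and F :: "'i \<Rightarrow> 'c" and Col :: "'c set"
  assumes cat: "finitary_adhesive_extensive_category C"
    and J_finite: "finite J"
    and rates: "\<And>j. j \<in> J \<Longrightarrow> \<kappa> j \<ge> 0"
    and rules: "\<And>j. j \<in> J \<Longrightarrow> linear_rule C (r j)"
    and h_def: "\<And>j. j \<in> J \<Longrightarrow> h j = delta C (r j)"
    and H_def: "H = hamiltonian C J \<kappa> h"
    and Ob_connected: "connected_observables C I Ob"
    and Ob_jump_closed: "poly_jump_closed C I Ob H"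
    and commutators: "\<And>i j v. \<lbrakk>i \<in> I; j \<in> J; v \<in> states C\<rbrakk>
      \<Longrightarrow> ad (Ob i) (rho C (h j)) v = of_int (\<eta> i j) *\<^sub>R rho C (h j) v"
    and k_multi_index: "\<And>j. j \<in> J \<Longrightarrow> Poly_Mapping.keys (k j) \<subseteq> I"
    and jumps: "\<And>j v. \<lbrakk>j \<in> J; v \<in> states C\<rbrakk>
      \<Longrightarrow> bra (rho C (h j) v) =
        \<alpha> j * (\<Sum>n | \<forall>i. Poly_Mapping.lookup n i \<le> Poly_Mapping.lookup (k j) i.
          s1_multi I (k j) n * bra (monomial_op I Ob n v))"
    and rules_discr_wf: "\<And>i j. \<lbrakk>i \<in> I; j \<in> J\<rbrakk>
      \<Longrightarrow> 0 \<le> \<eta> i j + int (Poly_Mapping.lookup (k j) i)"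
    and F_bij: "bij_betw F I Col"
  shows "moment_bisimilar C H I Ob
    (discrete_cat Col)
    (hamiltonian (discrete_cat Col) J (\<lambda>j. \<alpha> j * \<kappa> j)
      (\<lambda>j. delta (discrete_cat Col) (discrete_rule Col
        (\<lambda>c. let i = inv_into I F c in nat (\<eta> i j + int (Poly_Mapping.lookup (k j) i)))
        (\<lambda>c. let i = inv_into I F c in Poly_Mapping.lookup (k j) i))))
    Col (vertex_count Col) F"
proof -
  interpret C: finitary_adhesive_extensive_category C by (rule cat)
  let ?D = "discrete_cat Col"
  let ?k = "\<lambda>j c. Poly_Mapping.lookup (k j) (inv_into I F c)"
  let ?n = "\<lambda>j c. nat (\<eta> (inv_into I F c) j + int (?k j c))"
  let ?H = "hamiltonian ?D J (\<lambda>j. \<alpha> j * \<kappa> j) (\<lambda>j. delta ?D (discrete_rule Col (?n j) (?k j)))"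
  \<comment> \<open>The factor \<open>\<alpha> j * \<kappa> j\<close> is prefactor times rate on the
    given side and the whole rate on the discrete side.\<close>
  let ?S = "evolution_symbol I J (\<lambda>j. \<alpha> j * \<kappa> j) (\<lambda>i j. of_int (\<eta> i j)) k"
  have I: "finite I"
    using Ob_connected by (simp add: connected_observables_def)
  then have Col: "finite Col"
    using F_bij by (simp add: bij_betw_finite)
  have inv: "inv_into I F (F i) = i" if "i \<in> I" for i
    using F_bij that by (simp add: bij_betw_def)
  have inv_I: "inv_into I F c \<in> I" if "c \<in> Col" for c
    using F_bij that by (auto simp: bij_betw_def intro: inv_into_into)
  have S1: "conversion_symbol C I Ob H ?S"
    unfolding H_def
    by (rule C.conversion_symbol_hamiltonian[where r = r])
      (simp_all add: Ob_connected rules h_def commutators[unfolded h_def] k_multi_index jumps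
        bra_poly_jump_poly flip: h_def)
  \<comment> \<open>\<open>rules_discr_wf\<close> makes the conversion by \<open>nat\<close> exact,
    so output minus input is \<eta>.\<close>
  have S2: "conversion_symbol ?D I (vertex_count Col \<circ> F) ?H ?S"
    using rules_discr_wf by (intro conversion_symbol_discrete Col F_bij k_multi_index) (auto simp: inv)
  \<comment> \<open>The multi-index \<open>k j\<close> carried from I to Col along F; the value 0
    off Col keeps its support inside Col.\<close>
  define l where "l j = Abs_poly_mapping (\<lambda>c. if c \<in> Col then ?k j c else 0)" for j
  have l: "Poly_Mapping.lookup (l j) c = (if c \<in> Col then ?k j c else 0)" for j c
    unfolding l_def by (subst lookup_Abs_poly_mapping) (auto intro: finite_subset[OF _ Col])
  \<comment> \<open>\<open>moment_bisimilar\<close> asks for jump-closure over Col with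
    \<open>vertex_count Col\<close> itself, hence this second symbol, indexed by colours.\<close>
  have "conversion_symbol ?D Col (vertex_count Col \<circ> id) ?H
      (evolution_symbol Col J (\<lambda>j. \<alpha> j * \<kappa> j) (\<lambda>c j. of_int (\<eta> (inv_into I F c) j)) l)"
    using rules_discr_wf inv_I
    by (intro conversion_symbol_discrete Col bij_betw_id) (auto simp: l in_keys_iff split: if_splits)
  then have closed: "poly_jump_closed ?D Col (vertex_count Col) ?H"
    by (simp add: conversion_symbol_imp_poly_jump_closed)
  have "connected_observables ?D Col (vertex_count Col)"
    using connected_observables_vertex_count[OF Col Col, of id] by simp
  then show ?thesis
    unfolding moment_bisimilar_def Let_def
    using Ob_connected Ob_jump_closed closed F_bij S1 S2 by blast
qed

end
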